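(* Let $P(\lambda)$, $w$, $\mathcal{B}(P,\varepsilon,w)$, $\Lambda_\varepsilon(P)$ and the perturbations $\hat{Q}(\lambda),\tilde{Q}(\lambda)$ associated with a point $\mu$ be as in the context. Suppose that, as the parameter $\varepsilon>0$ increases, two different connected components $\mathcal{G}_1$ and $\mathcal{G}_2$ of $\Lambda_\varepsilon(P)\neq\mathbb{C}$ meet at $\mu\in\mathbb{C}$ (in the sense made precise in the context). Then the following hold. (i) If $\mu\neq 0$, then $\mu$ is a multiple eigenvalue of the perturbations $\hat{Q}(\lambda),\tilde{Q}(\lambda)\in\partial\mathcal{B}(P,\varepsilon,w)$. (ii) If $\mu=0$ and $w(x)=w_c(x)$, where $w_c(x)=w_0>0$ is the constant weight function, then $\mu=0$ is a multiple eigenvalue of the perturbations $\hat{Q}(\lambda),\tilde{Q}(\lambda)\in\partial\mathcal{B}(P,\varepsilon,w_c)$. (iii) If $\mu=0$, $w(x)\neq w_c(x)$, $\Lambda_\varepsilon(P)$ is bounded and the origin is the only intersection point of $\mathcal{G}_1$ and $\mathcal{G}_2$, then $\mu=0$ is a multiple eigenvalue of some perturbation on $\partial\mathcal{B}(P,\varepsilon,w)$. Furthermore, in cases (i) and (ii), if $s_n(\mu)$ is a simple singular value of $P(\mu)$, then $\mu$ is a defective eigenvalue of $\hat{Q}(\lambda)$ and of $\tilde{Q}(\lambda)$ with geometric multiplicity $1$.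
   Context: $P(\lambda)=P_m\lambda^m+\cdots+P_1\lambda+P_0$ with $m\ge 1$, $P_j\in\mathbb{C}^{n\times n}$ and $\det P_m\neq 0$. For a matrix polynomial $Q(\lambda)$, $\mu$ is an eigenvalue if $\det Q(\mu)=0$; its algebraic multiplicity is its order as a zero of $\det Q(\lambda)$, its geometric multiplicity is $\dim\ker Q(\mu)$; it is multiple if its algebraic multiplicity is at least $2$, and a multiple eigenvalue is defective if its algebraic multiplicity exceeds its geometric multiplicity. $\sigma(P)$ is the set of eigenvalues of $P$. The weight polynomial is $w(x)=\sum_{j=0}^m w_jx^j$ with real $w_j\ge 0$ for $j=1,\dots,m$ and $w_0>0$. $\|\cdot\|$ is the spectral matrix norm. For $\varepsilon\ge 0$, $\mathcal{B}(P,\varepsilon,w)$ is the set of $Q(\lambda)=\sum_{j=0}^m(P_j+\Delta_j)\lambda^j$ with $\|\Delta_j\|\le\varepsilon w_j$ for $j=0,\dots,m$; its boundary $\partial\mathcal{B}(P,\varepsilon,w)$ consists of those $Q\in\mathcal{B}(P,\varepsilon,w)$ for which $\|\Delta_j\|=\varepsilon w_j$ for at least one $j$ with $w_j>0$. $\Lambda_\varepsilon(P)=\{\mu\in\mathbb{C}:\det Q(\mu)=0\text{ for some }Q\in\mathcal{B}(P,\varepsilon,w)\}$; equivalently $\Lambda_\varepsilon(P)=\{\lambda: s_n(\lambda)\le\varepsilon w(|\lambda|)\}$, where $s_1(\lambda)\ge\cdots\ge s_n(\lambda)$ are the singular values of $P(\lambda)$. Meeting of components: "as $\varepsilon$ increases,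 two different connected components $\mathcal{G}_1,\mathcal{G}_2$ meet at $\mu$" means that there are $\eta\in(0,\varepsilon)$ and, for each $\delta\in[\eta,\varepsilon)$, two different connected components $\mathcal{G}_1(\delta)$, $\mathcal{G}_2(\delta)$ of $\Lambda_\delta(P)$, with $\mathcal{G}_j(\delta)\subseteq\mathcal{G}_j(\delta')$ for $\delta\le\delta'$, such that $\mu\in\mathcal{G}_1\cap\mathcal{G}_2$, where $\mathcal{G}_j$ denotes the closure of $\bigcup_{\eta\le\delta<\varepsilon}\mathcal{G}_j(\delta)$ (a subset of $\Lambda_\varepsilon(P)$). Perturbations $\hat Q,\tilde Q$: for $\mu\notin\sigma(P)$, let $s_n(\mu)>0$ have multiplicity $k$ as a singular value of $P(\mu)$, and let $u_1,\dots,u_n$ and $v_1,\dots,v_n$ be orthonormal bases of left and right singular vectors, $P(\mu)v_j=s_j(\mu)u_j$. Put $\hat{Z}=[u_1\cdots u_n][v_1\cdots v_n]^*$, $\tilde{Z}=[u_{n-k+1}\cdots u_n][v_{n-k+1}\cdots v_n]^*$, $\hat{E}=-s_n(\mu)\hat{Z}$, $\tilde{E}=-s_n(\mu)\tilde{Z}$, and for $j=0,\dots,m$ $$\hat\Delta_j=\Big(\frac{\overline\mu}{|\mu|}\Big)^j\frac{w_j}{w(|\mu|)}\hat E,\qquad \tilde\Delta_j=\Big(\frac{\overline\mu}{|\mu|}\Big)^j\frac{w_j}{w(|\mu|)}\tilde E,$$ with the conventions $\overline\mu/|\mu|=0$ when $\mu=0$ and $0^0=1$. When $\mu=0$ the constant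 weight $w_c(x)=w_0$ is used in place of $w$ in this construction. Then $\hat Q(\lambda)=\sum_{j=0}^m(P_j+\hat\Delta_j)\lambda^j$ and $\tilde Q(\lambda)=\sum_{j=0}^m(P_j+\tilde\Delta_j)\lambda^j$. *)

theory Defs
  imports "HOL-Analysis.Analysis" "HOL-Computational_Algebra.Polynomial"
begin

section \<open>Matrix polynomials and their eigenvalues\<close>

text \<open>A matrix polynomial is a matrix with polynomial entries, so that its determinant is
  itself a polynomial.\<close>

type_synonym 'n matpoly = "complex poly ^ 'n ^ 'n"

text \<open>\<open>matpoly m A\<close> is \<open>A m \<lambda>^m + \<dots> + A 1 \<lambda> + A 0\<close>; the values \<open>A j\<close> with \<open>j > m\<close> are ignored.\<close>

definition matpoly :: "nat \<Rightarrow> (nat \<Rightarrow> complex^'n^'n) \<Rightarrow> 'n::finite matpoly" where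
  "matpoly m A = (\<chi> i l. \<Sum>j\<le>m. monom (A j $ i $ l) j)"

definition mp_eval :: "'n::finite matpoly \<Rightarrow> complex \<Rightarrow> complex^'n^'n" where
  "mp_eval Q z = map_matrix (\<lambda>p. poly p z) Q"

lemma mp_eval_matpoly:
  "mp_eval (matpoly m A) z = (\<Sum>j\<le>m. map_matrix ((*) (z ^ j)) (A j))"
  by (simp add: mp_eval_def matpoly_def map_matrix_def vec_eq_iff poly_sum poly_monom mult.commute)

lemma poly_det: "poly (det Q) z = det (mp_eval Q z)"
  by (simp add: det_def mp_eval_def map_matrix_def poly_sum poly_prod)

definition eigenvalue :: "'n::finite matpoly \<Rightarrow> complex \<Rightarrow> bool" where
  "eigenvalue Q \<mu> \<longleftrightarrow> det (mp_eval Q \<mu>) = 0"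

definition alg_mult :: "'n::finite matpoly \<Rightarrow> complex \<Rightarrow> nat" where
  "alg_mult Q \<mu> = order \<mu> (det Q)"

text \<open>\<open>vec.dim\<close> is the dimension over the complex field; the unqualified \<open>dim\<close> would be the
  real one.\<close>

definition geo_mult :: "'n::finite matpoly \<Rightarrow> complex \<Rightarrow> nat" where
  "geo_mult Q \<mu> = vec.dim {x. mp_eval Q \<mu> *v x = 0}"

definition multiple_eigenvalue :: "'n::finite matpoly \<Rightarrow> complex \<Rightarrow> bool" where
  "multiple_eigenvalue Q \<mu> \<longleftrightarrow> eigenvalue Q \<mu> \<and> alg_mult Q \<mu> \<ge> 2"

definition defective_eigenvalue :: "'n::finite matpoly \<Rightarrow> complex \<Rightarrow> bool" where
  "defective_eigenvalue Q \<mu> \<longleftrightarrow> multiple_eigenvalue Q \<mu> \<and> alg_mult Q \<mu> > geo_mult Q \<mu>"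


section \<open>Perturbations and pseudospectra\<close>

definition weight_poly :: "nat \<Rightarrow> real poly \<Rightarrow> bool" where
  "weight_poly m w \<longleftrightarrow> degree w \<le> m \<and> (\<forall>j\<in>{1..m}. coeff w j \<ge> 0) \<and> coeff w 0 > 0"

definition const_weight :: "real poly \<Rightarrow> real poly" where
  "const_weight w = [:coeff w 0:]"

text \<open>The operator norm is taken with respect to the Euclidean norm of \<open>complex^'n\<close>. The
  type-class norm of matrices would be the Frobenius norm.\<close>

definition spectral_norm :: "complex^'n^'n::finite \<Rightarrow> real" where
  "spectral_norm A = onorm ((*v) A)"

definition pert_ball ::
  "nat \<Rightarrow> (nat \<Rightarrow> complex^'n^'n) \<Rightarrow> real \<Rightarrow> real poly \<Rightarrow> 'n::finite matpoly set" where
  "pert_ball m P \<epsilon> w = {matpoly m (\<lambda>j. P j + \<Delta> j) | \<Delta>.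
     \<forall>j\<le>m. spectral_norm (\<Delta> j) \<le> \<epsilon> * coeff w j}"

definition pert_boundary ::
  "nat \<Rightarrow> (nat \<Rightarrow> complex^'n^'n) \<Rightarrow> real \<Rightarrow> real poly \<Rightarrow> 'n::finite matpoly set" where
  "pert_boundary m P \<epsilon> w = {matpoly m (\<lambda>j. P j + \<Delta> j) | \<Delta>.
     (\<forall>j\<le>m. spectral_norm (\<Delta> j) \<le> \<epsilon> * coeff w j) \<and>
     (\<exists>j\<le>m. coeff w j > 0 \<and> spectral_norm (\<Delta> j) = \<epsilon> * coeff w j)}"

definition pseudospectrum ::
  "nat \<Rightarrow> (nat \<Rightarrow> complex^'n^'n::finite) \<Rightarrow> real poly \<Rightarrow> real \<Rightarrow> complex set" where
  "pseudospectrum m P w \<epsilon> = {\<mu>. \<exists>Q\<in>pert_ball m P \<epsilon> w. eigenvalue Q \<mu>}"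

text \<open>\<open>C1 \<delta>\<close> and \<open>C2 \<delta>\<close> are the two growing components; \<open>G1\<close> and \<open>G2\<close> are their limits as
  \<open>\<delta>\<close> increases to \<open>\<epsilon>\<close>.\<close>

definition components_meet ::
  "nat \<Rightarrow> (nat \<Rightarrow> complex^'n^'n::finite) \<Rightarrow> real poly \<Rightarrow> real \<Rightarrow>
   complex set \<Rightarrow> complex set \<Rightarrow> complex \<Rightarrow> bool" where
  "components_meet m P w \<epsilon> G1 G2 \<mu> \<longleftrightarrow>
     (\<exists>\<eta> C1 C2. 0 < \<eta> \<and> \<eta> < \<epsilon> \<and>
        (\<forall>\<delta>\<in>{\<eta>..<\<epsilon>}. C1 \<delta> \<in> components (pseudospectrum m P w \<delta>) \<and>
                       C2 \<delta> \<in> components (pseudospectrum m P w \<delta>) \<and>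
                       C1 \<delta> \<noteq> C2 \<delta>) \<and>
        (\<forall>\<delta>\<in>{\<eta>..<\<epsilon>}. \<forall>\<delta>'\<in>{\<eta>..<\<epsilon>}. \<delta> \<le> \<delta>' \<longrightarrow> C1 \<delta> \<subseteq> C1 \<delta>' \<and> C2 \<delta> \<subseteq> C2 \<delta>') \<and>
        G1 = closure (\<Union>\<delta>\<in>{\<eta>..<\<epsilon>}. C1 \<delta>) \<and>
        G2 = closure (\<Union>\<delta>\<in>{\<eta>..<\<epsilon>}. C2 \<delta>) \<and>
        \<mu> \<in> G1 \<inter> G2)"


section \<open>Singular value decompositions and the associated perturbations\<close>

definition cinner :: "complex^'n \<Rightarrow> complex^'n::finite \<Rightarrow> complex" where
  "cinner x y = (\<Sum>i\<in>UNIV. x $ i * cnj (y $ i))"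

text \<open>An orthonormal family indexed by \<open>1, \<dots>, CARD('n)\<close> is automatically a basis.\<close>

definition orthonormal_basis :: "(nat \<Rightarrow> complex^'n::finite) \<Rightarrow> bool" where
  "orthonormal_basis u \<longleftrightarrow>
     (\<forall>j\<in>{1..CARD('n)}. \<forall>l\<in>{1..CARD('n)}. cinner (u j) (u l) = (if j = l then 1 else 0))"

text \<open>\<open>s 1 \<ge> \<dots> \<ge> s n\<close> are the singular values of \<open>A\<close>, with right singular vectors \<open>v j\<close> and
  left singular vectors \<open>u j\<close>, where \<open>n = CARD('n)\<close>. Since \<open>u\<close> and \<open>v\<close> are bases, \<open>A\<close>
  is \<open>U diag(s) V*\<close>, so the dual relations \<open>A* u j = s j v j\<close> need not be demanded.\<close>

definition is_svd ::
  "complex^'n^'n::finite \<Rightarrow> (nat \<Rightarrow> real) \<Rightarrow> (nat \<Rightarrow> complex^'n) \<Rightarrow> (nat \<Rightarrow> complex^'n) \<Rightarrow> bool"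
where
  "is_svd A s u v \<longleftrightarrow>
     orthonormal_basis u \<and> orthonormal_basis v \<and>
     antimono_on {1..CARD('n)} s \<and>
     (\<forall>j\<in>{1..CARD('n)}. s j \<ge> 0 \<and> A *v v j = complex_of_real (s j) *s u j)"

text \<open>The multiplicity of the smallest among the singular values \<open>s 1, \<dots>, s n\<close>.\<close>

definition min_sv_mult :: "nat \<Rightarrow> (nat \<Rightarrow> real) \<Rightarrow> nat" where
  "min_sv_mult n s = card {j\<in>{1..n}. s j = s n}"

text \<open>The product \<open>[u_a \<dots> u_b] [v_a \<dots> v_b]*\<close> of matrices given by their columns.\<close>

definition cols_prod ::
  "nat \<Rightarrow> nat \<Rightarrow> (nat \<Rightarrow> complex^'n) \<Rightarrow> (nat \<Rightarrow> complex^'n) \<Rightarrow> complex^'n^'n::finite" where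
  "cols_prod a b u v = (\<chi> i l. \<Sum>j=a..b. u j $ i * cnj (v j $ l))"

definition E_hat ::
  "(nat \<Rightarrow> real) \<Rightarrow> (nat \<Rightarrow> complex^'n) \<Rightarrow> (nat \<Rightarrow> complex^'n) \<Rightarrow> complex^'n^'n::finite" where
  "E_hat s u v = (let n = CARD('n) in
     map_matrix ((*) (- complex_of_real (s n))) (cols_prod 1 n u v))"

definition E_tilde ::
  "(nat \<Rightarrow> real) \<Rightarrow> (nat \<Rightarrow> complex^'n) \<Rightarrow> (nat \<Rightarrow> complex^'n) \<Rightarrow> complex^'n^'n::finite" where
  "E_tilde s u v = (let n = CARD('n); k = min_sv_mult n s in
     map_matrix ((*) (- complex_of_real (s n))) (cols_prod (n - k + 1) n u v))"

text \<open>For \<open>\<mu> = 0\<close> the constant weight replaces \<open>w\<close>. The conventions that \<open>cnj \<mu> / \<bar>\<mu>\<bar>\<close> is \<open>0\<close>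
  at \<open>\<mu> = 0\<close> and that \<open>0 ^ 0 = 1\<close> hold for the HOL operations.\<close>

definition spread ::
  "real poly \<Rightarrow> complex \<Rightarrow> complex^'n^'n \<Rightarrow> nat \<Rightarrow> complex^'n^'n::finite" where
  "spread w \<mu> E j = (let w' = (if \<mu> = 0 then const_weight w else w) in
     map_matrix ((*) ((cnj \<mu> / complex_of_real (cmod \<mu>)) ^ j *
       complex_of_real (coeff w' j / poly w' (cmod \<mu>)))) E)"

definition Q_hat ::
  "nat \<Rightarrow> (nat \<Rightarrow> complex^'n^'n) \<Rightarrow> real poly \<Rightarrow> complex \<Rightarrow>
   (nat \<Rightarrow> real) \<Rightarrow> (nat \<Rightarrow> complex^'n) \<Rightarrow> (nat \<Rightarrow> complex^'n) \<Rightarrow> 'n::finite matpoly" where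
  "Q_hat m P w \<mu> s u v = matpoly m (\<lambda>j. P j + spread w \<mu> (E_hat s u v) j)"

definition Q_tilde ::
  "nat \<Rightarrow> (nat \<Rightarrow> complex^'n^'n) \<Rightarrow> real poly \<Rightarrow> complex \<Rightarrow>
   (nat \<Rightarrow> real) \<Rightarrow> (nat \<Rightarrow> complex^'n) \<Rightarrow> (nat \<Rightarrow> complex^'n) \<Rightarrow> 'n::finite matpoly" where
  "Q_tilde m P w \<mu> s u v = matpoly m (\<lambda>j. P j + spread w \<mu> (E_tilde s u v) j)"

end

theory Submission
  imports Defs
begin

text \<open>
  Write \<open>\<Lambda>\<^sub>\<delta>\<close> for the pseudospectrum, that is, the set of all \<open>z\<close> for which some unit vector \<open>x\<close> satisfies
  \<open>\<parallel>P(z)x\<parallel> \<le> \<delta> w(\<bar>z\<bar>)\<close>, and \<open>\<Omega>\<close> for the open set where \<open>\<parallel>P(z)x\<parallel> < \<epsilon> w(\<bar>z\<bar>)\<close> for some unit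
  vector. A compact connected subset of \<open>\<Omega>\<close> lies in \<open>\<Lambda>\<^sub>\<delta>\<close> for some \<open>\<delta> < \<epsilon>\<close>. If two components meet
  at \<open>\<mu>\<close>, there are hence points of \<open>\<Omega>\<close> arbitrarily close to \<open>\<mu>\<close> that cannot be joined inside \<open>\<Omega>\<close>. In
  particular \<open>\<mu>\<close> is not in \<open>\<Omega>\<close>, which gives \<open>s\<^sub>n(\<mu>) = \<epsilon> w(\<bar>\<mu>\<bar>) > 0\<close>
  (\<open>components_meet_not_joined\<close>, \<open>components_meet_boundary\<close>).

  Suppose that \<open>s\<^sub>n(\<mu>)\<close> is simple, with singular vectors \<open>u\<close> and \<open>v\<close>. If \<open>s\<^sub>n(z) - \<epsilon> w(\<bar>z\<bar>)\<close> decreased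
  uniformly near \<open>\<mu>\<close> in some direction \<open>d\<close>, any two nearby points of \<open>\<Omega>\<close> could be joined: move both along
  \<open>d\<close> into a small ball inside \<open>\<Omega>\<close>. So there is no such direction (\<open>uniform_descent\<close>,
  \<open>no_descent_direction\<close>). To first order the decrease is governed by \<open>u\<^sup>*P'(\<mu>)v\<close> and the derivative of
  \<open>w(\<bar>z\<bar>)\<close>. For \<open>\<mu> \<noteq> 0\<close>, or a constant weight, this forces
  \<open>u\<^sup>*P'(\<mu>)v = \<epsilon> w'(\<bar>\<mu>\<bar>) \<theta>\<close>, where \<open>\<theta>\<close> is the conjugate of \<open>\<mu>\<close> over \<open>\<bar>\<mu>\<bar>\<close>, and the
  perturbations are built so that \<open>Q(\<mu>)v = 0\<close>, \<open>u\<^sup>*Q(\<mu>) = 0\<close> and \<open>u\<^sup>*Q'(\<mu>)v\<close> is the difference of the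
  two sides, hence \<open>0\<close>. At the origin with a general weight one obtains
  \<open>\<bar>u\<^sup>*P\<^sub>1v\<bar> \<le> \<epsilon> w\<^sub>1\<close> instead, and an admissible perturbation of \<open>P\<^sub>1\<close> cancels this number
  (\<open>multiple_eigenvalue_at_origin\<close>).

  The three relations \<open>Q(\<mu>)v = 0\<close>, \<open>u\<^sup>*Q(\<mu>) = 0\<close>, \<open>u\<^sup>*Q'(\<mu>)v = 0\<close> make \<open>\<mu>\<close> a double zero of
  \<open>det Q\<close> (\<open>double_zero_det\<close>), and \<open>det Q\<close> does not vanish identically since \<open>\<Lambda>\<^sub>\<epsilon>\<close> is not the whole plane.
  If \<open>s\<^sub>n(\<mu>)\<close> is multiple, \<open>Q(\<mu>)\<close> has a left kernel of dimension at least two, so that a left null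
  vector satisfying the third relation always exists (\<open>lowered_double_zero\<close>). If it is simple, the kernel of
  \<open>Q(\<mu>)\<close> is the line spanned by \<open>v\<close>, and the multiple eigenvalue is defective.
\<close>

section \<open>The Hermitian inner product and scalar multiples of matrices\<close>

lemma Re_cinner: "Re (cinner x y) = inner x y"
  by (simp add: cinner_def inner_vec_def inner_complex_def)

lemma cinner_self: "cinner x x = complex_of_real ((norm x)\<^sup>2)"
proof -
  have "cinner x x = complex_of_real (\<Sum>i\<in>UNIV. (cmod (x $ i))\<^sup>2)"
    by (simp only: cinner_def complex_norm_square of_real_sum)
  then show ?thesis
    by (simp add: norm_vec_def L2_set_def sum_nonneg)
qed

lemma cnj_cinner: "cnj (cinner x y) = cinner y x"
  by (simp add: cinner_def mult.commute)

lemma cinner_add_left: "cinner (x + y) z = cinner x z + cinner y z"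
  by (simp add: cinner_def distrib_right sum.distrib)

lemma cinner_add_right: "cinner z (x + y) = cinner z x + cinner z y"
  by (simp add: cinner_def distrib_left sum.distrib)

lemma cinner_scale_left: "cinner (c *s x) y = c * cinner x y"
  by (simp add: cinner_def sum_distrib_left mult.assoc)

lemma cinner_scale_right: "cinner x (c *s y) = cnj c * cinner x y"
  by (simp add: cinner_def sum_distrib_left mult.left_commute)

lemma cinner_zero [simp]: "cinner 0 x = 0" "cinner x 0 = 0"
  by (simp_all add: cinner_def)

lemma cinner_sum_left: "cinner (sum f S) y = (\<Sum>j\<in>S. cinner (f j) y)"
  by (induction S rule: infinite_finite_induct) (simp_all add: cinner_add_left)

lemma cinner_sum_right: "cinner y (sum f S) = (\<Sum>j\<in>S. cinner y (f j))"
  by (induction S rule: infinite_finite_induct) (simp_all add: cinner_add_right)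

lemma norm_cscale: "norm (c *s (x :: complex^'n::finite)) = cmod c * norm x"
proof -
  have "complex_of_real ((norm (c *s x))\<^sup>2) = (c * cnj c) * cinner x x"
    by (simp only: cinner_self [symmetric] cinner_scale_left cinner_scale_right mult_ac)
  also have "\<dots> = complex_of_real ((cmod c * norm x)\<^sup>2)"
    by (simp add: cinner_self complex_norm_square [symmetric] power_mult_distrib)
  finally have "(norm (c *s x))\<^sup>2 = (cmod c * norm x)\<^sup>2"
    by (simp only: of_real_eq_iff)
  then show ?thesis
    by (simp add: power2_eq_iff_nonneg)
qed

text \<open>Rotating \<open>x\<close> by a phase makes the Hermitian product real and nonnegative; it is then the real
  inner product, to which the real Cauchy-Schwarz inequality applies.\<close>
lemma norm_cinner_le: "cmod (cinner x y) \<le> norm x * norm y"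
proof -
  define c where "c = (if cinner x y = 0 then 1 else cnj (cinner x y) / cmod (cinner x y))"
  have c: "cmod c = 1" "c * cinner x y = cmod (cinner x y)"
    by (auto simp: c_def norm_divide complex_norm_square [symmetric] power2_eq_square
        mult.commute [of "cnj _"])
  have "cmod (cinner x y) = Re (cinner (c *s x) y)"
    by (simp add: cinner_scale_left c)
  also have "\<dots> \<le> norm (c *s x) * norm y"
    by (simp add: Re_cinner norm_cauchy_schwarz)
  finally show ?thesis
    by (simp add: norm_cscale c)
qed

abbreviation cscale :: "complex \<Rightarrow> complex^'n^'n \<Rightarrow> complex^'n^'n::finite" where
  "cscale c A \<equiv> map_matrix ((*) c) A"

lemma cscale_mult_vec: "cscale c A *v x = c *s (A *v x)"
  by (simp add: matrix_vector_mult_def vec_eq_iff sum_distrib_left mult.assoc)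

lemma sum_mult_vec: "(\<Sum>j\<in>S. A j) *v x = (\<Sum>j\<in>S. A j *v x)" for A :: "_ \<Rightarrow> complex^'n^'n::finite"
  by (induction S rule: infinite_finite_induct) (simp_all add: matrix_vector_mult_add_rdistrib)

lemma norm_mult_vec_le: "norm (A *v x) \<le> spectral_norm A * norm x"
  unfolding spectral_norm_def by (rule onorm) simp

lemma spectral_norm_le:
  assumes "\<And>x. norm (A *v x) \<le> b * norm x"
  shows "spectral_norm A \<le> b"
  unfolding spectral_norm_def using assms by (rule onorm_le)

lemma spectral_norm_cscale: "spectral_norm (cscale c A) = cmod c * spectral_norm A"
proof (rule antisym)
  show le: "spectral_norm (cscale c A) \<le> cmod c * spectral_norm A" for c :: complex and A :: "complex^'n^'n::finite"
    by (rule spectral_norm_le)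
       (simp add: cscale_mult_vec norm_cscale mult.assoc mult_left_mono norm_mult_vec_le)
  show "cmod c * spectral_norm A \<le> spectral_norm (cscale c A)"
  proof (cases "c = 0")
    case True
    then show ?thesis
      by (simp add: spectral_norm_def onorm_pos_le)
  next
    case False
    have "cscale (inverse c) (cscale c A) = A"
      using False by (simp add: vec_eq_iff mult.assoc [symmetric])
    with le [of "inverse c" "cscale c A"] have "spectral_norm A \<le> spectral_norm (cscale c A) / cmod c"
      by (simp add: norm_inverse divide_inverse mult.commute)
    then show ?thesis
      using False by (simp add: field_simps)
  qed
qed

section \<open>Double zeros of the determinant\<close>

definition mp_deriv :: "'n::finite matpoly \<Rightarrow> 'n matpoly" where
  "mp_deriv Q = map_matrix pderiv Q"

lemma pderiv_sum: "pderiv (sum f S) = (\<Sum>j\<in>S. pderiv (f j))"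
  by (induction S rule: infinite_finite_induct) (simp_all add: pderiv_add)

lemma mp_eval_mp_deriv_matpoly:
  "mp_eval (mp_deriv (matpoly m A)) z = (\<Sum>j\<le>m. cscale (of_nat j * z ^ (j - 1)) (A j))"
proof -
  have "poly (pderiv (monom a j)) z = of_nat j * z ^ (j - 1) * a" for a :: complex and j
    by (simp add: pderiv_monom poly_monom)
  then show ?thesis
    by (simp add: mp_eval_def mp_deriv_def matpoly_def vec_eq_iff pderiv_sum poly_sum)
qed

definition mp_vec :: "'n::finite matpoly \<Rightarrow> complex^'n \<Rightarrow> 'n \<Rightarrow> complex poly" where
  "mp_vec Q x i = (\<Sum>l\<in>UNIV. smult (x $ l) (Q $ i $ l))"

lemma poly_mp_vec: "poly (mp_vec Q x i) z = (mp_eval Q z *v x) $ i"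
  by (simp add: mp_vec_def poly_sum mp_eval_def matrix_vector_mult_def mult.commute)

lemma poly_pderiv_mp_vec: "poly (pderiv (mp_vec Q x i)) z = (mp_eval (mp_deriv Q) z *v x) $ i"
  by (simp add: mp_vec_def pderiv_sum poly_sum mp_eval_def mp_deriv_def matrix_vector_mult_def
      pderiv_smult mult.commute)

text \<open>Let \<open>Q(\<lambda>)v = (\<lambda> - \<mu>) y(\<lambda>)\<close> and replace the \<open>k\<close>-th column of \<open>Q(\<lambda>)\<close>, where \<open>v\<^sub>k \<noteq> 0\<close>, by
  \<open>y(\<lambda>)\<close>. By Cramer's rule \<open>v\<^sub>k det Q(\<lambda>)\<close> is \<open>\<lambda> - \<mu>\<close> times the determinant of the new matrix. At
  \<open>\<mu>\<close> its new column is \<open>Q'(\<mu>)v\<close>, so that \<open>u\<close> annihilates all its columns and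
  its determinant vanishes at \<open>\<mu>\<close> again.\<close>
lemma double_zero_det:
  fixes Q :: "'n::finite matpoly"
  assumes v: "v \<noteq> 0" and Qv: "mp_eval Q \<mu> *v v = 0"
    and u: "u \<noteq> 0" and uQ: "\<And>x. cinner (mp_eval Q \<mu> *v x) u = 0"
    and uQv: "cinner (mp_eval (mp_deriv Q) \<mu> *v v) u = 0"
  shows "[:-\<mu>, 1:]\<^sup>2 dvd det Q"
proof -
  obtain k where k: "v $ k \<noteq> 0"
    using v by (auto simp: vec_eq_iff)
  have "\<forall>i. \<exists>y. mp_vec Q v i = [:-\<mu>, 1:] * y"
    using Qv poly_mp_vec [of Q v _ \<mu>] by (metis poly_eq_0_iff_dvd dvdE zero_index)
  then obtain y where y: "\<And>i. mp_vec Q v i = [:-\<mu>, 1:] * y i"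
    by metis
  have Qv_eq: "(mp_eval Q z *v v) $ i = (z - \<mu>) * poly (y i) z" for z i
    by (simp only: poly_mp_vec [symmetric] y) (simp add: algebra_simps)
  have y_mu: "poly (y i) \<mu> = (mp_eval (mp_deriv Q) \<mu> *v v) $ i" for i
    by (simp only: poly_pderiv_mp_vec [symmetric] y pderiv_mult) (simp add: pderiv_pCons)
  define N :: "'n matpoly" where "N = (\<chi> i j. if j = k then y i else Q $ i $ j)"
  have "poly (smult (v $ k) (det Q)) z = poly ([:-\<mu>, 1:] * det N) z" for z
  proof -
    have "poly (smult (v $ k) (det Q)) z = v $ k * det (mp_eval Q z)"
      by (simp add: poly_det)
    also have "\<dots> = det (\<chi> i j. if j = k then (mp_eval Q z *v v) $ i else mp_eval Q z $ i $ j)"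
      by (rule cramer_lemma [symmetric])
    also have "(\<chi> i j. if j = k then (mp_eval Q z *v v) $ i else mp_eval Q z $ i $ j)
        = (\<chi> i j. if j = k then (z - \<mu>) * mp_eval N z $ i $ j else mp_eval N z $ i $ j)"
      by (simp add: vec_eq_iff Qv_eq) (simp add: N_def mp_eval_def)
    also have "det \<dots> = det (transpose \<dots>)"
      by (rule det_transpose [symmetric])
    also have "transpose (\<chi> i j. if j = k then (z - \<mu>) * mp_eval N z $ i $ j else mp_eval N z $ i $ j)
        = (\<chi> j. if j = k then (z - \<mu>) *s transpose (mp_eval N z) $ j else transpose (mp_eval N z) $ j)"
      by (simp add: vec_eq_iff transpose_def left_diff_distrib)
    also have "det \<dots> = (z - \<mu>) * det (\<chi> j. if j = k then transpose (mp_eval N z) $ j else transpose (mp_eval N z) $ j)"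
      by (rule det_row_mul)
    also have "(\<chi> j. if j = k then transpose (mp_eval N z) $ j else transpose (mp_eval N z) $ j)
        = transpose (mp_eval N z)"
      by (simp add: vec_eq_iff)
    also have "(z - \<mu>) * det (transpose (mp_eval N z)) = poly ([:-\<mu>, 1:] * det N) z"
      by (simp add: det_transpose poly_det algebra_simps)
    finally show ?thesis .
  qed
  then have eq: "smult (v $ k) (det Q) = [:-\<mu>, 1:] * det N"
    by (intro poly_eq_poly_eq_iff [THEN iffD1] ext)
  have "(\<Sum>i\<in>UNIV. cnj (u $ i) * mp_eval N \<mu> $ i $ j) = 0" for j
  proof (cases "j = k")
    case True
    then show ?thesis
      using uQv by (simp add: N_def mp_eval_def y_mu cinner_def mult.commute)
  next
    case False
    have "(mp_eval Q \<mu> *v axis j 1) $ i = mp_eval Q \<mu> $ i $ j" for i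
      by (simp add: matrix_vector_mult_def axis_def if_distrib [where f = "(*) _"] cong: if_cong)
    with False have "(\<Sum>i\<in>UNIV. cnj (u $ i) * mp_eval N \<mu> $ i $ j) = cinner (mp_eval Q \<mu> *v axis j 1) u"
      by (simp add: cinner_def mult.commute) (simp add: N_def mp_eval_def)
    then show ?thesis
      using uQ by simp
  qed
  then have "transpose (mp_eval N \<mu>) *v (\<chi> i. cnj (u $ i)) = 0"
    by (simp add: vec_eq_iff matrix_vector_mult_def transpose_def mult.commute)
  moreover have "(\<chi> i. cnj (u $ i)) \<noteq> (0 :: complex^'n)"
    using u by (auto simp: vec_eq_iff)
  ultimately have "\<not> invertible (transpose (mp_eval N \<mu>))"
    by (metis invertible_left_inverse matrix_left_invertible_ker)
  then have "det (mp_eval N \<mu>) = 0"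
    by (metis invertible_det_nz det_transpose)
  then have "[:-\<mu>, 1:] dvd det N"
    by (simp add: poly_det poly_eq_0_iff_dvd [symmetric])
  then have "[:-\<mu>, 1:]\<^sup>2 dvd smult (v $ k) (det Q)"
    unfolding eq power2_eq_square by (rule mult_dvd_mono [OF dvd_refl])
  then show ?thesis
    using k by (simp add: dvd_smult_iff)
qed

lemma multiple_eigenvalueI:
  assumes "det Q \<noteq> 0" and "[:-\<mu>, 1:]\<^sup>2 dvd det Q"
  shows "multiple_eigenvalue Q \<mu>"
proof -
  have "2 \<le> order \<mu> (det Q)"
    using assms by (simp add: order_divides)
  moreover have "poly (det Q) \<mu> = 0"
    using calculation order_root [of "det Q" \<mu>] assms(1) by auto
  ultimately show ?thesis
    by (simp add: multiple_eigenvalue_def eigenvalue_def alg_mult_def poly_det)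
qed


section \<open>Pseudospectra as sublevel sets\<close>

abbreviation cpoly :: "real poly \<Rightarrow> complex poly" where
  "cpoly w \<equiv> map_poly complex_of_real w"

lemma poly_cpoly: "poly (cpoly w) (complex_of_real r) = complex_of_real (poly w r)"
  by (induction w) (simp_all add: map_poly_pCons)

lemma pderiv_cpoly: "pderiv (cpoly w) = cpoly (pderiv w)"
  by (rule poly_eqI) (simp add: coeff_pderiv coeff_map_poly)

lemma degree_cpoly_le: "degree (cpoly w) \<le> degree w"
  by (rule degree_le) (simp add: coeff_map_poly coeff_eq_0)

lemma poly_eq_sum_coeff:
  fixes p :: "'a::comm_semiring_1 poly"
  assumes "degree p \<le> m"
  shows "poly p x = (\<Sum>j\<le>m. coeff p j * x ^ j)"
  unfolding poly_altdef using assms by (intro sum.mono_neutral_left) (auto simp: coeff_eq_0)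

lemma weight_poly_coeff_nonneg:
  assumes "weight_poly m w"
  shows "coeff w j \<ge> 0"
  using assms coeff_eq_0 [of w j] unfolding weight_poly_def
  by (cases "j = 0"; cases "j \<le> m") (auto simp: order_less_imp_le)

lemma weight_poly_pos:
  assumes "weight_poly m w" and "r \<ge> 0"
  shows "poly w r > 0"
proof -
  have "poly w r = (\<Sum>j\<le>m. coeff w j * r ^ j)"
    using assms(1) by (simp add: poly_eq_sum_coeff [of w m] weight_poly_def)
  also have "\<dots> \<ge> (\<Sum>j\<in>{0}. coeff w j * r ^ j)"
    by (rule sum_mono2) (auto simp: weight_poly_coeff_nonneg [OF assms(1)] assms(2))
  finally show ?thesis
    using assms(1) by (simp add: weight_poly_def)
qed

lemma norm_poly_cpoly_le:
  assumes "weight_poly m w"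
  shows "cmod (poly (cpoly w) z) \<le> poly w (cmod z)"
proof -
  have "cmod (poly (cpoly w) z) = cmod (\<Sum>j\<le>m. coeff w j * z ^ j)"
    using assms degree_cpoly_le [of w]
    by (subst poly_eq_sum_coeff [of _ m]) (auto simp: weight_poly_def coeff_map_poly)
  also have "\<dots> \<le> (\<Sum>j\<le>m. coeff w j * cmod z ^ j)"
    by (rule sum_norm_le) (simp add: norm_mult norm_power weight_poly_coeff_nonneg [OF assms])
  also have "\<dots> = poly w (cmod z)"
    using assms by (simp add: poly_eq_sum_coeff [of w m] weight_poly_def)
  finally show ?thesis .
qed

lemma ex_phase: "\<exists>\<theta>. cmod \<theta> = 1 \<and> \<theta> * z = complex_of_real (cmod z)"
  by (rule exI [of _ "if z = 0 then 1 else cnj z / cmod z"])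
     (auto simp: norm_divide complex_norm_square [symmetric] power2_eq_square mult.commute [of "cnj _"])

lemma mp_eval_perturbed:
  "mp_eval (matpoly m (\<lambda>j. P j + D j)) z = mp_eval (matpoly m P) z + (\<Sum>j\<le>m. cscale (z ^ j) (D j))"
  by (simp add: mp_eval_matpoly vec_eq_iff distrib_left sum.distrib)

definition outer :: "complex^'n \<Rightarrow> complex^'n \<Rightarrow> complex^'n^'n::finite" where
  "outer y x = (\<chi> i l. y $ i * cnj (x $ l))"

lemma outer_mult_vec: "outer y x *v a = cinner a x *s y"
  by (simp add: vec_eq_iff outer_def matrix_vector_mult_def cinner_def sum_distrib_left
      sum_distrib_right mult_ac)

lemma spectral_norm_outer_le: "spectral_norm (outer y x) \<le> norm y * norm x"
proof (rule spectral_norm_le)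
  fix a :: "complex^'a"
  have "norm (outer y x *v a) = cmod (cinner a x) * norm y"
    by (simp add: outer_mult_vec norm_cscale)
  also have "\<dots> \<le> (norm a * norm x) * norm y"
    by (rule mult_right_mono [OF norm_cinner_le]) simp
  finally show "norm (outer y x *v a) \<le> norm y * norm x * norm a"
    by (simp add: mult_ac)
qed

text \<open>Since \<open>s\<^sub>n(z)\<close> is the minimum of \<open>\<parallel>P(z)x\<parallel>\<close> over the unit vectors \<open>x\<close>, these are the sets
  \<open>s\<^sub>n(z) \<le> \<delta> w(\<bar>z\<bar>)\<close> and \<open>s\<^sub>n(z) < \<delta> w(\<bar>z\<bar>)\<close>. Working with test vectors \<open>x\<close> instead of \<open>s\<^sub>n\<close> avoids
  questions about the regularity of singular values.\<close>
definition sublevel :: "'n::finite matpoly \<Rightarrow> real poly \<Rightarrow> real \<Rightarrow> complex set" where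
  "sublevel Q w \<delta> = {z. \<exists>x. norm x = 1 \<and> norm (mp_eval Q z *v x) \<le> \<delta> * poly w (cmod z)}"

definition strict_sublevel :: "'n::finite matpoly \<Rightarrow> real poly \<Rightarrow> real \<Rightarrow> complex set" where
  "strict_sublevel Q w \<delta> = {z. \<exists>x. norm x = 1 \<and> norm (mp_eval Q z *v x) < \<delta> * poly w (cmod z)}"

lemma sum_weighted_phase:
  assumes "weight_poly m w"
  shows "(\<Sum>j\<le>m. cscale (z ^ j) (cscale (\<theta> ^ j * complex_of_real (coeff w j / W)) E))
    = cscale (poly (cpoly w) (\<theta> * z) / complex_of_real W) E"
proof -
  have "poly (cpoly w) (\<theta> * z) = (\<Sum>j\<le>m. coeff w j * (\<theta> * z) ^ j)"
    using assms degree_cpoly_le [of w]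
    by (subst poly_eq_sum_coeff [of _ m]) (auto simp: weight_poly_def coeff_map_poly)
  then show ?thesis
    by (simp add: vec_eq_iff sum_divide_distrib sum_distrib_left power_mult_distrib mult_ac)
qed

text \<open>A null vector of a perturbed matrix polynomial is a test vector by the triangle inequality. Conversely, given a
  test vector \<open>x\<close>, the rank-one matrix \<open>- P(z)x x\<^sup>*\<close> is distributed over the coefficients in
  proportion to the weights, with the powers of a phase \<open>\<theta>\<close>, \<open>\<theta>z = \<bar>z\<bar>\<close>, making all contributions at \<open>z\<close> add
  up without cancellation.\<close>
lemma pseudospectrum_eq_sublevel:
  assumes w: "weight_poly m w" and "\<delta> \<ge> 0"
  shows "pseudospectrum m P w \<delta> = sublevel (matpoly m P) w \<delta>"
proof (intro equalityI subsetI)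
  fix z assume "z \<in> pseudospectrum m P w \<delta>"
  then obtain D where D: "\<And>j. j \<le> m \<Longrightarrow> spectral_norm (D j) \<le> \<delta> * coeff w j"
    and det: "det (mp_eval (matpoly m (\<lambda>j. P j + D j)) z) = 0"
    by (auto simp: pseudospectrum_def pert_ball_def eigenvalue_def)
  have "\<exists>a. mp_eval (matpoly m (\<lambda>j. P j + D j)) z *v a = 0 \<and> a \<noteq> 0"
    using det by (metis invertible_det_nz invertible_left_inverse matrix_left_invertible_ker)
  then obtain a where a: "mp_eval (matpoly m (\<lambda>j. P j + D j)) z *v a = 0" "a \<noteq> 0"
    by blast
  define x where "x = complex_of_real (inverse (norm a)) *s a"
  have x: "norm x = 1"
    using a(2) by (simp add: x_def norm_cscale norm_inverse)
  have "mp_eval (matpoly m (\<lambda>j. P j + D j)) z *v x = 0"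
    by (simp add: x_def vec.scale a(1))
  then have "mp_eval (matpoly m P) z *v x = - (\<Sum>j\<le>m. z ^ j *s (D j *v x))"
    by (simp add: mp_eval_perturbed matrix_vector_mult_add_rdistrib sum_mult_vec cscale_mult_vec
        eq_neg_iff_add_eq_0)
  then have "norm (mp_eval (matpoly m P) z *v x) = norm (\<Sum>j\<le>m. z ^ j *s (D j *v x))"
    by simp
  also have "\<dots> \<le> (\<Sum>j\<le>m. \<delta> * (coeff w j * cmod z ^ j))"
  proof (rule sum_norm_le)
    fix j assume "j \<in> {..m}"
    then have "norm (D j *v x) \<le> \<delta> * coeff w j"
      using norm_mult_vec_le [of "D j" x] D [of j] x by simp
    then show "norm (z ^ j *s (D j *v x)) \<le> \<delta> * (coeff w j * cmod z ^ j)"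
      using mult_right_mono [of "norm (D j *v x)" "\<delta> * coeff w j" "cmod z ^ j"]
      by (simp add: norm_cscale norm_power mult_ac)
  qed
  also have "\<dots> = \<delta> * poly w (cmod z)"
    using w by (simp add: poly_eq_sum_coeff [of w m] weight_poly_def sum_distrib_left)
  finally show "z \<in> sublevel (matpoly m P) w \<delta>"
    using x by (auto simp: sublevel_def)
next
  fix z assume "z \<in> sublevel (matpoly m P) w \<delta>"
  then obtain x where x: "norm x = 1" "norm (mp_eval (matpoly m P) z *v x) \<le> \<delta> * poly w (cmod z)"
    by (auto simp: sublevel_def)
  define y where "y = mp_eval (matpoly m P) z *v x"
  define W where "W = poly w (cmod z)"
  have W: "W > 0"
    unfolding W_def by (rule weight_poly_pos [OF w]) simp
  obtain \<theta> where \<theta>: "cmod \<theta> = 1" "\<theta> * z = complex_of_real (cmod z)"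
    using ex_phase by blast
  define D where "D j = cscale (\<theta> ^ j * complex_of_real (coeff w j / W)) (outer (- y) x)" for j
  have "spectral_norm (D j) \<le> \<delta> * coeff w j" for j
  proof -
    have "spectral_norm (D j) = coeff w j / W * spectral_norm (outer (- y) x)"
      using W weight_poly_coeff_nonneg [OF w, of j]
      by (simp add: D_def spectral_norm_cscale norm_mult norm_power \<theta>(1) norm_divide)
    also have "\<dots> \<le> coeff w j / W * (\<delta> * W)"
      using spectral_norm_outer_le [of "- y" x] x W weight_poly_coeff_nonneg [OF w, of j]
      by (intro mult_left_mono) (simp_all add: W_def y_def)
    also have "\<dots> = \<delta> * coeff w j"
      using W by simp
    finally show ?thesis .
  qed
  moreover have "mp_eval (matpoly m (\<lambda>j. P j + D j)) z *v x = 0"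
  proof -
    have "poly (cpoly w) (\<theta> * z) / complex_of_real W = 1"
      using W by (simp add: \<theta>(2) poly_cpoly W_def)
    then have "(\<Sum>j\<le>m. cscale (z ^ j) (D j)) *v x = - y"
      unfolding D_def sum_weighted_phase [OF w]
      by (simp add: cscale_mult_vec outer_mult_vec cinner_self x(1))
    then show ?thesis
      by (simp add: mp_eval_perturbed matrix_vector_mult_add_rdistrib y_def)
  qed
  then have "det (mp_eval (matpoly m (\<lambda>j. P j + D j)) z) = 0"
    using x(1) by (metis invertible_det_nz invertible_left_inverse matrix_left_invertible_ker
        norm_zero zero_neq_one)
  ultimately show "z \<in> pseudospectrum m P w \<delta>"
    by (auto simp: pseudospectrum_def pert_ball_def eigenvalue_def)
qed

lemma tendsto_mp_eval:
  assumes "(f \<longlongrightarrow> z) F" and "(g \<longlongrightarrow> x) F"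
  shows "((\<lambda>n. mp_eval Q (f n) *v g n) \<longlongrightarrow> mp_eval Q z *v x) F"
  unfolding matrix_vector_mult_def mp_eval_def
  by (intro tendsto_vec_lambda) (auto intro!: tendsto_intros assms)

lemma open_strict_sublevel: "open (strict_sublevel Q w \<delta>)"
proof -
  have "open {z. norm (mp_eval Q z *v x) < \<delta> * poly w (cmod z)}" for x
    by (intro open_Collect_less continuous_intros) (simp add: continuous_on_def tendsto_mp_eval)
  then have "open (\<Union>x\<in>{x. norm x = 1}. {z. norm (mp_eval Q z *v x) < \<delta> * poly w (cmod z)})"
    by blast
  also have "(\<Union>x\<in>{x. norm x = 1}. {z. norm (mp_eval Q z *v x) < \<delta> * poly w (cmod z)})
      = strict_sublevel Q w \<delta>"
    by (auto simp: strict_sublevel_def)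
  finally show ?thesis .
qed

lemma closed_sublevel: "closed (sublevel Q w \<delta>)"
  unfolding closed_sequential_limits
proof (intro allI impI, elim conjE)
  fix z l assume "\<forall>n. z n \<in> sublevel Q w \<delta>" and z: "z \<longlonglongrightarrow> l"
  then have "\<forall>n. \<exists>x. norm x = 1 \<and> norm (mp_eval Q (z n) *v x) \<le> \<delta> * poly w (cmod (z n))"
    by (simp add: sublevel_def)
  then obtain x where x: "\<And>n. norm (x n) = 1"
    and le: "\<And>n. norm (mp_eval Q (z n) *v x n) \<le> \<delta> * poly w (cmod (z n))"
    by metis
  have "compact (sphere (0 :: complex^'a) 1)"
    by simp
  then obtain a r where a: "a \<in> sphere 0 1" "strict_mono r" "(x \<circ> r) \<longlonglongrightarrow> a"
    unfolding compact_def using x by (metis dist_0_norm mem_sphere)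
  have zr: "(\<lambda>n. z (r n)) \<longlonglongrightarrow> l"
    using LIMSEQ_subseq_LIMSEQ [OF z a(2)] by (simp add: o_def)
  have "(\<lambda>n. norm (mp_eval Q (z (r n)) *v x (r n))) \<longlonglongrightarrow> norm (mp_eval Q l *v a)"
    using a(3) by (intro tendsto_norm tendsto_mp_eval zr) (simp add: o_def)
  moreover have "(\<lambda>n. \<delta> * poly w (cmod (z (r n)))) \<longlonglongrightarrow> \<delta> * poly w (cmod l)"
    by (intro tendsto_intros zr)
  ultimately have "norm (mp_eval Q l *v a) \<le> \<delta> * poly w (cmod l)"
    by (rule LIMSEQ_le) (use le in blast)
  then show "l \<in> sublevel Q w \<delta>"
    using a(1) by (auto simp: sublevel_def)
qed

lemma sublevel_mono:
  assumes "weight_poly m w" and "\<delta> \<le> \<delta>'"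
  shows "sublevel Q w \<delta> \<subseteq> sublevel Q w \<delta>'" and "strict_sublevel Q w \<delta> \<subseteq> sublevel Q w \<delta>'"
proof -
  have "\<delta> * poly w (cmod z) \<le> \<delta>' * poly w (cmod z)" for z
    using weight_poly_pos [OF assms(1), of "cmod z"] assms(2) by (simp add: mult_right_mono)
  then have "\<And>t z. t \<le> \<delta> * poly w (cmod z) \<Longrightarrow> t \<le> \<delta>' * poly w (cmod z)"
    "\<And>t z. t < \<delta> * poly w (cmod z) \<Longrightarrow> t < \<delta>' * poly w (cmod z)"
    by (meson order_trans less_le_trans)+
  then show "sublevel Q w \<delta> \<subseteq> sublevel Q w \<delta>'" "strict_sublevel Q w \<delta> \<subseteq> sublevel Q w \<delta>'"
    unfolding sublevel_def strict_sublevel_def by (auto intro: order_less_imp_le)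
qed

lemma sublevel_subset_strict_sublevel:
  assumes "weight_poly m w" and "\<delta> < \<delta>'"
  shows "sublevel Q w \<delta> \<subseteq> strict_sublevel Q w \<delta>'"
proof -
  have "\<delta> * poly w (cmod z) < \<delta>' * poly w (cmod z)" for z
    using weight_poly_pos [OF assms(1), of "cmod z"] assms(2) by (simp add: mult_strict_right_mono)
  then have "\<And>t z. t \<le> \<delta> * poly w (cmod z) \<Longrightarrow> t < \<delta>' * poly w (cmod z)"
    by (meson le_less_trans)
  then show ?thesis
    unfolding sublevel_def strict_sublevel_def by auto
qed

section \<open>Components that meet cannot be joined below the level where they meet\<close>

text \<open>The strict sublevel set is the increasing union of the open strict sublevel sets of the levels below.\<close>
lemma compact_subset_sublevel:
  assumes w: "weight_poly m w" and "\<eta> < \<epsilon>"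
    and K: "compact K" "K \<subseteq> strict_sublevel Q w \<epsilon>"
  shows "\<exists>\<delta>\<in>{\<eta>..<\<epsilon>}. K \<subseteq> sublevel Q w \<delta>"
proof -
  have "K \<subseteq> (\<Union>\<delta>\<in>{\<eta>..<\<epsilon>}. strict_sublevel Q w \<delta>)"
  proof
    fix z assume "z \<in> K"
    then obtain x where x: "norm x = 1" "norm (mp_eval Q z *v x) < \<epsilon> * poly w (cmod z)"
      using K(2) by (auto simp: strict_sublevel_def)
    have pos: "poly w (cmod z) > 0"
      by (rule weight_poly_pos [OF w]) simp
    have "max \<eta> (norm (mp_eval Q z *v x) / poly w (cmod z)) < \<epsilon>"
      using x(2) pos \<open>\<eta> < \<epsilon>\<close> by (simp add: divide_less_eq)
    then obtain \<delta> where "max \<eta> (norm (mp_eval Q z *v x) / poly w (cmod z)) < \<delta>" "\<delta> < \<epsilon>"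
      using dense by blast
    then show "z \<in> (\<Union>\<delta>\<in>{\<eta>..<\<epsilon>}. strict_sublevel Q w \<delta>)"
      using x(1) pos by (auto simp: strict_sublevel_def divide_less_eq intro!: bexI [of _ \<delta>])
  qed
  then obtain F where F: "F \<subseteq> {\<eta>..<\<epsilon>}" "finite F" "K \<subseteq> (\<Union>\<delta>\<in>F. strict_sublevel Q w \<delta>)"
    by (rule compactE_image [OF K(1) open_strict_sublevel])
  have "Max (insert \<eta> F) \<in> insert \<eta> F"
    using F(2) by (intro Max_in) auto
  then have "Max (insert \<eta> F) \<in> {\<eta>..<\<epsilon>}"
    using F(1) \<open>\<eta> < \<epsilon>\<close> by auto
  moreover have "strict_sublevel Q w \<delta> \<subseteq> sublevel Q w (Max (insert \<eta> F))" if "\<delta> \<in> F" for \<delta>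
    using that F(2) by (intro sublevel_mono(2) [OF w]) (auto intro: Max_ge)
  ultimately show ?thesis
    using F(3) by blast
qed

text \<open>A compact connected subset of the strict sublevel set already lies in \<open>\<Lambda>\<^sub>\<delta>(P)\<close> for
  some \<open>\<delta> < \<epsilon>\<close>; if it touched both growing components, they would coincide at that \<open>\<delta>\<close>.\<close>
lemma components_meet_not_joined:
  assumes w: "weight_poly m w" and meet: "components_meet m P w \<epsilon> G1 G2 \<mu>"
  shows "\<mu> \<in> sublevel (matpoly m P) w \<epsilon>"
    and "r > 0 \<Longrightarrow> \<exists>z1\<in>ball \<mu> r. \<exists>z2\<in>ball \<mu> r.
      z1 \<in> strict_sublevel (matpoly m P) w \<epsilon> \<and> z2 \<in> strict_sublevel (matpoly m P) w \<epsilon> \<and>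
      \<not> (\<exists>K. compact K \<and> connected K \<and> K \<subseteq> strict_sublevel (matpoly m P) w \<epsilon> \<and> z1 \<in> K \<and> z2 \<in> K)"
proof -
  let ?\<Lambda> = "sublevel (matpoly m P) w"
  obtain \<eta> C1 C2 where \<eta>: "0 < \<eta>" "\<eta> < \<epsilon>"
    and C: "\<forall>\<delta>\<in>{\<eta>..<\<epsilon>}. C1 \<delta> \<in> components (pseudospectrum m P w \<delta>) \<and>
        C2 \<delta> \<in> components (pseudospectrum m P w \<delta>) \<and> C1 \<delta> \<noteq> C2 \<delta>"
    and mono: "\<forall>\<delta>\<in>{\<eta>..<\<epsilon>}. \<forall>\<delta>'\<in>{\<eta>..<\<epsilon>}. \<delta> \<le> \<delta>' \<longrightarrow> C1 \<delta> \<subseteq> C1 \<delta>' \<and> C2 \<delta> \<subseteq> C2 \<delta>'"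
    and G: "G1 = closure (\<Union>\<delta>\<in>{\<eta>..<\<epsilon>}. C1 \<delta>)" "G2 = closure (\<Union>\<delta>\<in>{\<eta>..<\<epsilon>}. C2 \<delta>)"
      "\<mu> \<in> G1 \<inter> G2"
    using meet unfolding components_meet_def by (elim exE conjE) (rule that; assumption)
  have \<mu>: "\<mu> \<in> closure (\<Union>\<delta>\<in>{\<eta>..<\<epsilon>}. C1 \<delta>)" "\<mu> \<in> closure (\<Union>\<delta>\<in>{\<eta>..<\<epsilon>}. C2 \<delta>)"
    using G by simp_all
  have comp: "C1 \<delta> \<in> components (?\<Lambda> \<delta>)" "C2 \<delta> \<in> components (?\<Lambda> \<delta>)" "C1 \<delta> \<noteq> C2 \<delta>"
    if "\<delta> \<in> {\<eta>..<\<epsilon>}" for \<delta>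
    using C [rule_format, OF that] that \<eta>(1) by (simp_all add: pseudospectrum_eq_sublevel [OF w])
  have "(\<Union>\<delta>\<in>{\<eta>..<\<epsilon>}. C1 \<delta>) \<subseteq> ?\<Lambda> \<epsilon>"
  proof
    fix z assume "z \<in> (\<Union>\<delta>\<in>{\<eta>..<\<epsilon>}. C1 \<delta>)"
    then obtain \<delta> where \<delta>: "\<delta> \<in> {\<eta>..<\<epsilon>}" "z \<in> C1 \<delta>"
      by blast
    then have "z \<in> ?\<Lambda> \<delta>"
      using in_components_subset [OF comp(1)] by blast
    then show "z \<in> ?\<Lambda> \<epsilon>"
      using \<delta>(1) sublevel_mono(1) [OF w, of \<delta> \<epsilon>] by auto
  qed
  then show "\<mu> \<in> ?\<Lambda> \<epsilon>"
    using \<mu>(1) closure_minimal [OF _ closed_sublevel] by blast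
  assume "r > 0"
  then obtain \<delta>1 z1 \<delta>2 z2 where z: "\<delta>1 \<in> {\<eta>..<\<epsilon>}" "z1 \<in> C1 \<delta>1" "dist z1 \<mu> < r"
    "\<delta>2 \<in> {\<eta>..<\<epsilon>}" "z2 \<in> C2 \<delta>2" "dist z2 \<mu> < r"
    using \<mu> unfolding closure_approachable by blast
  have "z1 \<in> strict_sublevel (matpoly m P) w \<epsilon>" "z2 \<in> strict_sublevel (matpoly m P) w \<epsilon>"
    using z in_components_subset [OF comp(1) [OF z(1)]] in_components_subset [OF comp(2) [OF z(4)]]
      sublevel_subset_strict_sublevel [OF w, of \<delta>1 \<epsilon>] sublevel_subset_strict_sublevel [OF w, of \<delta>2 \<epsilon>]
    by (simp_all, blast+)
  moreover have False
    if K: "compact K" "connected K" "K \<subseteq> strict_sublevel (matpoly m P) w \<epsilon>" "z1 \<in> K" "z2 \<in> K" for K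
  proof -
    obtain \<delta>3 where \<delta>3: "\<delta>3 \<in> {\<eta>..<\<epsilon>}" "K \<subseteq> ?\<Lambda> \<delta>3"
      using compact_subset_sublevel [OF w \<eta>(2) K(1,3)] by blast
    define \<delta> where "\<delta> = max \<delta>3 (max \<delta>1 \<delta>2)"
    have \<delta>: "\<delta> \<in> {\<eta>..<\<epsilon>}" "\<delta>1 \<le> \<delta>" "\<delta>2 \<le> \<delta>" "\<delta>3 \<le> \<delta>"
      using z \<delta>3 by (auto simp: \<delta>_def)
    have K\<delta>: "K \<subseteq> ?\<Lambda> \<delta>"
      using \<delta>3(2) sublevel_mono(1) [OF w \<delta>(4)] by blast
    have "z1 \<in> C1 \<delta>" "z2 \<in> C2 \<delta>"
      using mono [rule_format, OF z(1) \<delta>(1,2)] mono [rule_format, OF z(4) \<delta>(1,3)] z(2,5) by auto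
    then have "K \<subseteq> C1 \<delta>" "K \<subseteq> C2 \<delta>"
      using components_maximal [OF comp(1) [OF \<delta>(1)] K(2) K\<delta>]
        components_maximal [OF comp(2) [OF \<delta>(1)] K(2) K\<delta>] K(4,5) by blast+
    then show False
      using comp [OF \<delta>(1)] components_nonoverlap K(4) by blast
  qed
  ultimately show "\<exists>z1\<in>ball \<mu> r. \<exists>z2\<in>ball \<mu> r.
      z1 \<in> strict_sublevel (matpoly m P) w \<epsilon> \<and> z2 \<in> strict_sublevel (matpoly m P) w \<epsilon> \<and>
      \<not> (\<exists>K. compact K \<and> connected K \<and> K \<subseteq> strict_sublevel (matpoly m P) w \<epsilon> \<and> z1 \<in> K \<and> z2 \<in> K)"
    using z(3,6) by (intro bexI [of _ z1] bexI [of _ z2]) (auto simp: dist_commute)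
qed

text \<open>A ball inside the open strict sublevel set would join any two of its points.\<close>
lemma components_meet_boundary:
  assumes w: "weight_poly m w" and meet: "components_meet m P w \<epsilon> G1 G2 \<mu>"
  shows "\<mu> \<notin> strict_sublevel (matpoly m P) w \<epsilon>"
proof
  assume "\<mu> \<in> strict_sublevel (matpoly m P) w \<epsilon>"
  then obtain r where r: "r > 0" "ball \<mu> r \<subseteq> strict_sublevel (matpoly m P) w \<epsilon>"
    using open_strict_sublevel open_contains_ball by blast
  obtain z1 z2 where "z1 \<in> ball \<mu> r" "z2 \<in> ball \<mu> r"
    and no: "\<not> (\<exists>K. compact K \<and> connected K \<and> K \<subseteq> strict_sublevel (matpoly m P) w \<epsilon> \<and> z1 \<in> K \<and> z2 \<in> K)"
    using components_meet_not_joined(2) [OF w meet r(1)] by blast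
  then have "closed_segment z1 z2 \<subseteq> ball \<mu> r"
    by (simp add: closed_segment_subset)
  then show False
    using no r(2) by (metis compact_segment connected_segment(1) ends_in_segment subset_trans)
qed


section \<open>A direction of uniform descent\<close>

lemma has_real_derivative_cmod_power2:
  assumes "(g has_vector_derivative g') (at s)"
  shows "((\<lambda>s. (cmod (g s))\<^sup>2) has_real_derivative 2 * inner (g s) g') (at s)"
proof -
  have "((\<lambda>s. inner (g s) (g s)) has_derivative (\<lambda>h. inner (g s) (h *\<^sub>R g') + inner (h *\<^sub>R g') (g s))) (at s)"
    using assms unfolding has_vector_derivative_def by (intro has_derivative_inner)
  moreover have "(\<lambda>h. inner (g s) (h *\<^sub>R g') + inner (h *\<^sub>R g') (g s)) = (*) (2 * inner (g s) g')"
    by (simp add: fun_eq_iff inner_commute [of g'])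
  ultimately show ?thesis
    by (simp add: has_field_derivative_def power2_norm_eq_inner)
qed

lemma has_vector_derivative_poly_line:
  "((\<lambda>s. poly p (\<theta> * (z + complex_of_real s * d))) has_vector_derivative
    d * (\<theta> * poly (pderiv p) (\<theta> * (z + complex_of_real s * d)))) (at s)"
proof -
  have "((\<lambda>s. \<theta> * (z + complex_of_real s * d)) has_vector_derivative \<theta> * d) (at s)"
    unfolding has_vector_derivative_def
    by (auto intro!: derivative_eq_intros simp: scaleR_conv_of_real)
  from field_vector_diff_chain_at [OF this poly_DERIV [of p]] show ?thesis
    by (simp add: o_def mult_ac)
qed

text \<open>Half the derivative at \<open>s = 0\<close> of \<open>\<parallel>Q(z + sd)x\<parallel>\<^sup>2 - \<epsilon>\<^sup>2\<bar>w(\<theta>(z + sd))\<bar>\<^sup>2\<close>.\<close>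
definition descent_rate ::
  "'n::finite matpoly \<Rightarrow> real poly \<Rightarrow> real \<Rightarrow> complex \<Rightarrow> complex \<Rightarrow> complex^'n \<Rightarrow> complex \<Rightarrow> real" where
  "descent_rate Q w \<epsilon> d z x \<theta> =
     inner (mp_eval Q z *v x) (d *s (mp_eval (mp_deriv Q) z *v x))
     - \<epsilon>\<^sup>2 * inner (poly (cpoly w) (\<theta> * z)) (d * (\<theta> * poly (pderiv (cpoly w)) (\<theta> * z)))"

lemma has_real_derivative_descent_rate:
  "((\<lambda>s. (norm (mp_eval Q (z + complex_of_real s * d) *v x))\<^sup>2
       - \<epsilon>\<^sup>2 * (cmod (poly (cpoly w) (\<theta> * (z + complex_of_real s * d))))\<^sup>2)
    has_real_derivative 2 * descent_rate Q w \<epsilon> d (z + complex_of_real s * d) x \<theta>) (at s)"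
proof -
  let ?z = "\<lambda>s. z + complex_of_real s * d"
  have norm_eq: "(norm (mp_eval Q (?z s) *v x))\<^sup>2 = (\<Sum>i\<in>UNIV. (cmod (poly (mp_vec Q x i) (?z s)))\<^sup>2)" for s
    by (simp add: norm_vec_def L2_set_def sum_nonneg poly_mp_vec)
  have "((\<lambda>s. (cmod (poly (mp_vec Q x i) (?z s)))\<^sup>2) has_real_derivative
      2 * inner ((mp_eval Q (?z s) *v x) $ i) ((d *s (mp_eval (mp_deriv Q) (?z s) *v x)) $ i)) (at s)" for i
    using has_real_derivative_cmod_power2 [OF has_vector_derivative_poly_line [of "mp_vec Q x i" 1 z d s]]
    by (simp add: poly_mp_vec poly_pderiv_mp_vec)
  then have "((\<lambda>s. (norm (mp_eval Q (?z s) *v x))\<^sup>2) has_real_derivative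
      2 * inner (mp_eval Q (?z s) *v x) (d *s (mp_eval (mp_deriv Q) (?z s) *v x))) (at s)"
    unfolding norm_eq inner_vec_def sum_distrib_left by (intro DERIV_sum) simp
  from DERIV_diff [OF this DERIV_cmult [OF has_real_derivative_cmod_power2
        [OF has_vector_derivative_poly_line [of "cpoly w" \<theta> z d s]], of "\<epsilon>\<^sup>2"]]
  show ?thesis
    by (simp add: descent_rate_def algebra_simps)
qed

lemma tendsto_descent_rate:
  assumes "(z \<longlongrightarrow> z0) F" and "(x \<longlongrightarrow> x0) F" and "(\<theta> \<longlongrightarrow> \<theta>0) F"
  shows "((\<lambda>n. descent_rate Q w \<epsilon> d (z n) (x n) (\<theta> n)) \<longlongrightarrow> descent_rate Q w \<epsilon> d z0 x0 \<theta>0) F"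
  unfolding descent_rate_def vector_scalar_mult_def
  by (intro tendsto_intros tendsto_vec_lambda tendsto_mp_eval assms)

text \<open>For a phase \<open>\<theta>\<close> with \<open>\<theta>z = \<bar>z\<bar>\<close> the holomorphic function \<open>w(\<theta>\<zeta>)\<close> is a minorant of
  \<open>w(\<bar>\<zeta>\<bar>)\<close> in modulus, with equality at \<open>z\<close>. So the test vector of \<open>z\<close> and the
  phase of \<open>z\<close> certify membership of the nearby points \<open>z + sd\<close>: the difference
  \<open>\<parallel>P(\<zeta>)x\<parallel>\<^sup>2 - \<epsilon>\<^sup>2\<bar>w(\<theta>\<zeta>)\<bar>\<^sup>2\<close> is smooth in \<open>s\<close>, even where \<open>s\<^sub>n\<close> or \<open>\<bar>\<zeta>\<bar>\<close> is not. Compactness of the unit vectors and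
  phases makes its decrease uniform near \<open>\<mu>\<close>.\<close>
lemma uniform_descent:
  assumes w: "weight_poly m w" and "\<epsilon> > 0"
    and rate: "\<And>x \<theta>. norm x = 1 \<Longrightarrow> norm (mp_eval Q \<mu> *v x) \<le> \<epsilon> * poly w (cmod \<mu>) \<Longrightarrow>
      cmod \<theta> = 1 \<Longrightarrow> \<theta> * \<mu> = complex_of_real (cmod \<mu>) \<Longrightarrow> descent_rate Q w \<epsilon> d \<mu> x \<theta> < 0"
  shows "\<exists>r>0. \<forall>z\<in>ball \<mu> r \<inter> sublevel Q w \<epsilon>. \<forall>s\<in>{0<..r}.
    z + complex_of_real s * d \<in> strict_sublevel Q w \<epsilon>"
proof (rule ccontr)
  assume neg: "\<not> ?thesis"
  have "\<forall>n. \<exists>z s. dist \<mu> z < 1 / real (Suc n) \<and> z \<in> sublevel Q w \<epsilon> \<and> 0 < s \<and> s \<le> 1 / real (Suc n)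
      \<and> z + complex_of_real s * d \<notin> strict_sublevel Q w \<epsilon>"
  proof
    fix n
    have "\<not> (\<forall>z\<in>ball \<mu> (1 / real (Suc n)) \<inter> sublevel Q w \<epsilon>. \<forall>s\<in>{0<..1 / real (Suc n)}.
        z + complex_of_real s * d \<in> strict_sublevel Q w \<epsilon>)"
      using neg by (metis of_nat_0_less_iff zero_less_Suc zero_less_divide_1_iff)
    then show "\<exists>z s. dist \<mu> z < 1 / real (Suc n) \<and> z \<in> sublevel Q w \<epsilon> \<and> 0 < s \<and> s \<le> 1 / real (Suc n)
      \<and> z + complex_of_real s * d \<notin> strict_sublevel Q w \<epsilon>"
      unfolding Ball_def Int_iff mem_ball greaterThanAtMost_iff by blast
  qed
  then obtain z s where near: "\<And>n. dist \<mu> (z n) < 1 / real (Suc n)" "\<And>n. s n \<le> 1 / real (Suc n)"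
    and zs: "\<And>n. z n \<in> sublevel Q w \<epsilon>" "\<And>n. 0 < s n"
    and out: "\<And>n. z n + complex_of_real (s n) * d \<notin> strict_sublevel Q w \<epsilon>"
    by metis
  obtain x where x: "\<And>n. norm (x n) = 1"
    and le: "\<And>n. norm (mp_eval Q (z n) *v x n) \<le> \<epsilon> * poly w (cmod (z n))"
    using zs(1) unfolding sublevel_def by (simp, metis)
  have "\<forall>n. \<exists>\<theta>. cmod \<theta> = 1 \<and> \<theta> * z n = complex_of_real (cmod (z n))"
    by (intro allI ex_phase)
  then obtain \<theta> where \<theta>: "\<And>n. cmod (\<theta> n) = 1" "\<And>n. \<theta> n * z n = complex_of_real (cmod (z n))"
    by metis
  define H where "H n t = (norm (mp_eval Q (z n + complex_of_real t * d) *v x n))\<^sup>2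
       - \<epsilon>\<^sup>2 * (cmod (poly (cpoly w) (\<theta> n * (z n + complex_of_real t * d))))\<^sup>2" for n t
  \<comment> \<open>The phase makes the minorant exact at the starting point.\<close>
  have start: "H n 0 \<le> 0" for n
  proof -
    have "(norm (mp_eval Q (z n) *v x n))\<^sup>2 \<le> (\<epsilon> * poly w (cmod (z n)))\<^sup>2"
      by (rule power_mono [OF le]) simp
    then show ?thesis
      by (simp add: H_def \<theta>(2) poly_cpoly power_mult_distrib)
  qed
  have stop: "H n (s n) \<ge> 0" for n
  proof -
    let ?y = "z n + complex_of_real (s n) * d"
    have "\<epsilon> * cmod (poly (cpoly w) (\<theta> n * ?y)) \<le> \<epsilon> * poly w (cmod ?y)"
      using norm_poly_cpoly_le [OF w, of "\<theta> n * ?y"] \<open>\<epsilon> > 0\<close> by (simp add: norm_mult \<theta>(1))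
    also have "\<dots> \<le> norm (mp_eval Q ?y *v x n)"
      using out [of n] x [of n] by (auto simp: strict_sublevel_def not_less)
    finally have "(\<epsilon> * cmod (poly (cpoly w) (\<theta> n * ?y)))\<^sup>2 \<le> (norm (mp_eval Q ?y *v x n))\<^sup>2"
      by (rule power_mono) (use \<open>\<epsilon> > 0\<close> in simp)
    then show ?thesis
      by (simp add: H_def power_mult_distrib)
  qed
  have "\<exists>t. 0 < t \<and> t < s n \<and> descent_rate Q w \<epsilon> d (z n + complex_of_real t * d) (x n) (\<theta> n) \<ge> 0" for n
  proof -
    have "(H n has_real_derivative 2 * descent_rate Q w \<epsilon> d (z n + complex_of_real t * d) (x n) (\<theta> n)) (at t)" for t
      unfolding H_def by (rule has_real_derivative_descent_rate)
    from MVT2 [OF zs(2) this] obtain t where t: "0 < t" "t < s n"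
      and "H n (s n) - H n 0 = (s n - 0) * (2 * descent_rate Q w \<epsilon> d (z n + complex_of_real t * d) (x n) (\<theta> n))"
      by blast
    then have "0 \<le> s n * (2 * descent_rate Q w \<epsilon> d (z n + complex_of_real t * d) (x n) (\<theta> n))"
      using start [of n] stop [of n] by simp
    then show ?thesis
      using t zs(2) [of n] by (auto simp: zero_le_mult_iff)
  qed
  then obtain t where t: "\<And>n. 0 < t n" "\<And>n. t n < s n"
    and nonneg: "\<And>n. descent_rate Q w \<epsilon> d (z n + complex_of_real (t n) * d) (x n) (\<theta> n) \<ge> 0"
    by metis
  have "compact (sphere (0 :: complex^'a) 1 \<times> sphere (0 :: complex) 1)"
    by (intro compact_Times compact_sphere)
  then have "(\<forall>n. (x n, \<theta> n) \<in> sphere 0 1 \<times> sphere 0 1) \<longrightarrow>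
      (\<exists>a\<in>sphere 0 1 \<times> sphere 0 1. \<exists>r. strict_mono r \<and> ((\<lambda>n. (x n, \<theta> n)) \<circ> r) \<longlonglongrightarrow> a)"
    unfolding compact_def by (rule spec)
  then obtain a r where a: "a \<in> sphere 0 1 \<times> sphere 0 1" "strict_mono r"
    and lim: "((\<lambda>n. (x n, \<theta> n)) \<circ> r) \<longlonglongrightarrow> a"
    using x \<theta>(1) by auto
  have xr: "(\<lambda>n. x (r n)) \<longlonglongrightarrow> fst a" and \<theta>r: "(\<lambda>n. \<theta> (r n)) \<longlonglongrightarrow> snd a"
    using tendsto_fst [OF lim] tendsto_snd [OF lim] by (simp_all add: o_def)
  have inv: "(\<lambda>n. 1 / real (Suc n)) \<longlonglongrightarrow> 0"
    using LIMSEQ_inverse_real_of_nat by (simp add: inverse_eq_divide)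
  have "(\<lambda>n. dist (z n) \<mu>) \<longlonglongrightarrow> 0"
    by (rule tendsto_sandwich [OF _ _ tendsto_const inv])
       (use near(1) in \<open>auto intro!: always_eventually simp: dist_commute less_imp_le\<close>)
  then have "z \<longlonglongrightarrow> \<mu>"
    by (rule tendsto_dist_iff [THEN iffD2])
  from LIMSEQ_subseq_LIMSEQ [OF this a(2)] have zr: "(\<lambda>n. z (r n)) \<longlonglongrightarrow> \<mu>"
    by (simp add: o_def)
  have "t n \<le> 1 / real (Suc n)" for n
    using t(2) [of n] near(2) [of n] by linarith
  then have "t \<longlonglongrightarrow> 0"
    by (intro tendsto_sandwich [OF _ _ tendsto_const inv])
       (use t(1) in \<open>auto intro!: always_eventually less_imp_le\<close>)
  from LIMSEQ_subseq_LIMSEQ [OF this a(2)] have tr: "(\<lambda>n. t (r n)) \<longlonglongrightarrow> 0"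
    by (simp add: o_def)
  have "(\<lambda>n. z (r n) + complex_of_real (t (r n)) * d) \<longlonglongrightarrow> \<mu> + complex_of_real 0 * d"
    by (intro tendsto_intros zr tr)
  then have "(\<lambda>n. descent_rate Q w \<epsilon> d (z (r n) + complex_of_real (t (r n)) * d) (x (r n)) (\<theta> (r n)))
      \<longlonglongrightarrow> descent_rate Q w \<epsilon> d \<mu> (fst a) (snd a)"
    using xr \<theta>r by (intro tendsto_descent_rate) simp_all
  then have "descent_rate Q w \<epsilon> d \<mu> (fst a) (snd a) \<ge> 0"
    by (rule LIMSEQ_le_const) (use nonneg in blast)
  moreover have "norm (mp_eval Q \<mu> *v fst a) \<le> \<epsilon> * poly w (cmod \<mu>)"
  proof (rule LIMSEQ_le)
    show "(\<lambda>n. norm (mp_eval Q (z (r n)) *v x (r n))) \<longlonglongrightarrow> norm (mp_eval Q \<mu> *v fst a)"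
      by (intro tendsto_norm tendsto_mp_eval zr xr)
    show "(\<lambda>n. \<epsilon> * poly w (cmod (z (r n)))) \<longlonglongrightarrow> \<epsilon> * poly w (cmod \<mu>)"
      by (intro tendsto_intros zr)
  qed (use le in blast)
  moreover have "snd a * \<mu> = complex_of_real (cmod \<mu>)"
  proof (rule LIMSEQ_unique)
    show "(\<lambda>n. \<theta> (r n) * z (r n)) \<longlonglongrightarrow> snd a * \<mu>"
      by (intro tendsto_intros \<theta>r zr)
    show "(\<lambda>n. \<theta> (r n) * z (r n)) \<longlonglongrightarrow> complex_of_real (cmod \<mu>)"
      unfolding \<theta>(2) by (intro tendsto_intros zr)
  qed
  ultimately show False
    using rate [of "fst a" "snd a"] a(1) by (auto simp: mem_Times_iff)
qed

text \<open>With a direction of descent any two nearby points of the strict sublevel set are joined inside it: move both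
  in the direction \<open>d\<close> until they reach a ball around \<open>\<mu> + rd\<close> that lies in the set.\<close>
lemma no_descent_direction:
  assumes w: "weight_poly m w" and meet: "components_meet m P w \<epsilon> G1 G2 \<mu>" and "\<epsilon> > 0"
  shows "\<exists>x \<theta>. norm x = 1 \<and> norm (mp_eval (matpoly m P) \<mu> *v x) \<le> \<epsilon> * poly w (cmod \<mu>) \<and>
    cmod \<theta> = 1 \<and> \<theta> * \<mu> = complex_of_real (cmod \<mu>) \<and> descent_rate (matpoly m P) w \<epsilon> d \<mu> x \<theta> \<ge> 0"
proof (rule ccontr)
  let ?S = "strict_sublevel (matpoly m P) w \<epsilon>"
  assume "\<not> ?thesis"
  then have "\<exists>r>0. \<forall>z\<in>ball \<mu> r \<inter> sublevel (matpoly m P) w \<epsilon>. \<forall>s\<in>{0<..r}. z + complex_of_real s * d \<in> ?S"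
    by (intro uniform_descent [OF w \<open>\<epsilon> > 0\<close>]) (meson not_le)
  then obtain r where r: "r > 0"
    and down: "\<And>z s. z \<in> ball \<mu> r \<Longrightarrow> z \<in> sublevel (matpoly m P) w \<epsilon> \<Longrightarrow> 0 < s \<Longrightarrow> s \<le> r \<Longrightarrow>
      z + complex_of_real s * d \<in> ?S"
    by (metis IntI greaterThanAtMost_iff)
  define p where "p = complex_of_real r * d"
  have "\<mu> + p \<in> ?S"
    unfolding p_def using r components_meet_not_joined(1) [OF w meet] by (intro down) auto
  then obtain r' where r': "r' > 0" "ball (\<mu> + p) r' \<subseteq> ?S"
    using open_strict_sublevel open_contains_ball by blast
  obtain z1 z2 where z: "z1 \<in> ball \<mu> (min r r')" "z2 \<in> ball \<mu> (min r r')" "z1 \<in> ?S" "z2 \<in> ?S"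
    and no: "\<not> (\<exists>K. compact K \<and> connected K \<and> K \<subseteq> ?S \<and> z1 \<in> K \<and> z2 \<in> K)"
    using components_meet_not_joined(2) [OF w meet, of "min r r'"] r r' by auto
  have leg: "closed_segment z' (z' + p) \<subseteq> ?S" if "z' \<in> ball \<mu> (min r r')" "z' \<in> ?S" for z'
  proof
    fix y assume "y \<in> closed_segment z' (z' + p)"
    then obtain u where u: "0 \<le> u" "u \<le> 1" "y = (1 - u) *\<^sub>R z' + u *\<^sub>R (z' + p)"
      by (auto simp: in_segment)
    then have y: "y = z' + complex_of_real (u * r) * d"
      by (simp add: p_def scaleR_conv_of_real algebra_simps)
    show "y \<in> ?S"
    proof (cases "u = 0")
      case True
      then show ?thesis
        using y that by simp
    next
      case False
      then show ?thesis
        unfolding y using u r that sublevel_mono(2) [OF w order_refl, of "matpoly m P" \<epsilon>]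
        by (intro down) (auto simp: mult_left_le_one_le)
    qed
  qed
  have mid: "closed_segment (z1 + p) (z2 + p) \<subseteq> ?S"
  proof -
    have "z1 + p \<in> ball (\<mu> + p) r'" "z2 + p \<in> ball (\<mu> + p) r'"
      using z by (auto simp: dist_norm)
    then have "closed_segment (z1 + p) (z2 + p) \<subseteq> ball (\<mu> + p) r'"
      by (simp add: closed_segment_subset)
    then show ?thesis
      using r'(2) by blast
  qed
  let ?K = "closed_segment z1 (z1 + p) \<union> (closed_segment (z1 + p) (z2 + p) \<union> closed_segment z2 (z2 + p))"
  have "connected ?K"
    using ends_in_segment [of "z1 + p"] ends_in_segment [of _ "z1 + p"] ends_in_segment [of _ "z2 + p"]
    by (intro connected_Un connected_segment) blast+
  moreover have "compact ?K"
    by (intro compact_Un compact_segment)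
  moreover have "?K \<subseteq> ?S"
    using leg [OF z(1,3)] leg [OF z(2,4)] mid by blast
  ultimately show False
    using no by blast
qed


section \<open>Expansions in singular vectors\<close>

lemma orthonormal_basisD:
  fixes v :: "nat \<Rightarrow> complex^'n::finite"
  assumes "orthonormal_basis v" and "j \<in> {1..CARD('n)}"
  shows "l \<in> {1..CARD('n)} \<Longrightarrow> cinner (v j) (v l) = (if j = l then 1 else 0)"
    and "norm (v j) = 1" and "v j \<noteq> 0"
proof -
  show "l \<in> {1..CARD('n)} \<Longrightarrow> cinner (v j) (v l) = (if j = l then 1 else 0)"
    using assms by (auto simp: orthonormal_basis_def)
  have "cinner (v j) (v j) = 1"
    using assms by (auto simp: orthonormal_basis_def)
  then have "(norm (v j))\<^sup>2 = 1"
    unfolding cinner_self by (simp only: of_real_eq_1_iff)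
  then show "norm (v j) = 1"
    by (simp add: power2_eq_1_iff) (use norm_ge_zero [of "v j"] in linarith)
  then show "v j \<noteq> 0"
    by auto
qed

text \<open>Orthonormality says that the adjoint of the matrix with columns \<open>v\<^sub>j\<close> is a left inverse. It is then a right
  inverse as well, which is the expansion.\<close>
lemma orthonormal_expansion:
  fixes v :: "nat \<Rightarrow> complex^'n::finite"
  assumes v: "orthonormal_basis v"
  shows "x = (\<Sum>j=1..CARD('n). cinner x (v j) *s v j)"
proof -
  have "card (UNIV :: 'n set) = card {1..CARD('n)}"
    by simp
  then obtain b :: "'n \<Rightarrow> nat" where b: "bij_betw b UNIV {1..CARD('n)}"
    by (metis finite finite_atLeastAtMost finite_same_card_bij)
  have b_mem: "b k \<in> {1..CARD('n)}" and b_inj: "b k = b l \<longleftrightarrow> k = l" for k l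
    using b by (auto simp: bij_betw_def inj_eq)
  define V :: "complex^'n^'n" where "V = (\<chi> i k. v (b k) $ i)"
  define V' :: "complex^'n^'n" where "V' = (\<chi> k i. cnj (v (b k) $ i))"
  have "(V' ** V) $ k $ l = (mat 1 :: complex^'n^'n) $ k $ l" for k l
  proof -
    have "(V' ** V) $ k $ l = cinner (v (b l)) (v (b k))"
      by (simp add: matrix_matrix_mult_def V'_def V_def cinner_def mult.commute)
    then show ?thesis
      using orthonormal_basisD(1) [OF v b_mem b_mem] by (simp add: mat_def b_inj)
  qed
  then have "V' ** V = mat 1"
    by (simp add: vec_eq_iff)
  then have "V ** V' = mat 1"
    by (simp add: matrix_left_right_inverse)
  then have "x = V *v (V' *v x)"
    by (simp add: matrix_vector_mul_assoc)
  also have "V' *v x = (\<chi> k. cinner x (v (b k)))"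
    by (simp add: vec_eq_iff matrix_vector_mult_def V'_def cinner_def mult.commute)
  also have "V *v \<dots> = (\<Sum>k\<in>UNIV. cinner x (v (b k)) *s v (b k))"
    by (simp add: vec_eq_iff matrix_vector_mult_def V_def mult.commute)
  also have "\<dots> = (\<Sum>j=1..CARD('n). cinner x (v j) *s v j)"
    using b by (rule sum.reindex_bij_betw)
  finally show ?thesis .
qed

lemma cinner_orthonormal_sum:
  fixes v :: "nat \<Rightarrow> complex^'n::finite"
  assumes v: "orthonormal_basis v" and S: "S \<subseteq> {1..CARD('n)}" and l: "l \<in> {1..CARD('n)}"
  shows "cinner (\<Sum>j\<in>S. c j *s v j) (v l) = (if l \<in> S then c l else 0)"
proof -
  have "cinner (\<Sum>j\<in>S. c j *s v j) (v l) = (\<Sum>j\<in>S. c j * (if j = l then 1 else 0))"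
    unfolding cinner_sum_left cinner_scale_left
    using orthonormal_basisD(1) [OF v _ l] S by (intro sum.cong) (auto simp: subset_iff)
  then show ?thesis
    using finite_subset [OF S] by (simp add: if_distrib [where f = "(*) _"] cong: if_cong)
qed

lemma norm_orthonormal_sum:
  fixes v :: "nat \<Rightarrow> complex^'n::finite"
  assumes v: "orthonormal_basis v" and S: "S \<subseteq> {1..CARD('n)}"
  shows "(norm (\<Sum>j\<in>S. c j *s v j))\<^sup>2 = (\<Sum>j\<in>S. (cmod (c j))\<^sup>2)"
proof -
  have "complex_of_real ((norm (\<Sum>j\<in>S. c j *s v j))\<^sup>2)
      = (\<Sum>l\<in>S. cnj (c l) * cinner (\<Sum>j\<in>S. c j *s v j) (v l))"
    unfolding cinner_self [symmetric] by (subst cinner_sum_right) (simp only: cinner_scale_right)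
  also have "\<dots> = (\<Sum>l\<in>S. complex_of_real ((cmod (c l))\<^sup>2))"
    using S cinner_orthonormal_sum [OF v S] by (intro sum.cong) (auto simp: complex_norm_square mult.commute subset_iff simp del: of_real_power)
  finally show ?thesis
    by (simp only: of_real_sum [symmetric] of_real_eq_iff)
qed

lemma parseval:
  fixes v :: "nat \<Rightarrow> complex^'n::finite"
  assumes "orthonormal_basis v"
  shows "(norm x)\<^sup>2 = (\<Sum>j=1..CARD('n). (cmod (cinner x (v j)))\<^sup>2)"
  using norm_orthonormal_sum [OF assms, of "{1..CARD('n)}" "\<lambda>j. cinner x (v j)"]
    orthonormal_expansion [OF assms, of x] by simp

lemma is_svdD:
  fixes A :: "complex^'n^'n::finite"
  assumes "is_svd A s u v"
  shows "orthonormal_basis u" "orthonormal_basis v" "antimono_on {1..CARD('n)} s"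
    "j \<in> {1..CARD('n)} \<Longrightarrow> s j \<ge> 0" "j \<in> {1..CARD('n)} \<Longrightarrow> A *v v j = complex_of_real (s j) *s u j"
    "j \<in> {1..CARD('n)} \<Longrightarrow> s CARD('n) \<le> s j"
proof -
  show "j \<in> {1..CARD('n)} \<Longrightarrow> s CARD('n) \<le> s j"
    using assms monotone_onD [of "{1..CARD('n)}" "(\<le>)" "(\<ge>)" s j "CARD('n)"]
    by (auto simp: is_svd_def)
qed (use assms in \<open>auto simp: is_svd_def\<close>)

lemma svd_mult_vec:
  fixes A :: "complex^'n^'n::finite"
  assumes "is_svd A s u v"
  shows "A *v x = (\<Sum>j=1..CARD('n). (s j * cinner x (v j)) *s u j)"
proof -
  have "A *v x = A *v (\<Sum>j=1..CARD('n). cinner x (v j) *s v j)"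
    using orthonormal_expansion [OF is_svdD(2) [OF assms], of x] by simp
  also have "\<dots> = (\<Sum>j=1..CARD('n). cinner x (v j) *s (A *v v j))"
    by (simp add: vec.sum vec.scale)
  also have "\<dots> = (\<Sum>j=1..CARD('n). (s j * cinner x (v j)) *s u j)"
    using is_svdD(5) [OF assms] by (intro sum.cong) (auto simp: vector_smult_assoc mult.commute)
  finally show ?thesis .
qed

lemma norm_svd_mult_vec:
  fixes A :: "complex^'n^'n::finite"
  assumes "is_svd A s u v"
  shows "(norm (A *v x))\<^sup>2 = (\<Sum>j=1..CARD('n). (s j * cmod (cinner x (v j)))\<^sup>2)"
  unfolding svd_mult_vec [OF assms] norm_orthonormal_sum [OF is_svdD(1) [OF assms] order_refl]
  by (simp add: norm_mult power_mult_distrib)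

lemma min_sv_le:
  fixes A :: "complex^'n^'n::finite"
  assumes "is_svd A s u v"
  shows "s CARD('n) * norm x \<le> norm (A *v x)"
proof (rule power2_le_imp_le)
  have "(s CARD('n) * norm x)\<^sup>2 = (\<Sum>j=1..CARD('n). (s CARD('n) * cmod (cinner x (v j)))\<^sup>2)"
    by (simp add: power_mult_distrib parseval [OF is_svdD(2) [OF assms]] sum_distrib_left)
  also have "\<dots> \<le> (norm (A *v x))\<^sup>2"
    unfolding norm_svd_mult_vec [OF assms]
    using is_svdD(4,6) [OF assms] by (intro sum_mono power_mono mult_right_mono) auto
  finally show "(s CARD('n) * norm x)\<^sup>2 \<le> (norm (A *v x))\<^sup>2" .
qed simp

lemma min_sv_mult_ge_1: "n \<ge> 1 \<Longrightarrow> min_sv_mult n s \<ge> 1"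
  unfolding min_sv_mult_def by (auto simp: Suc_le_eq card_gt_0_iff)

lemma min_sv_mult_eq_1D:
  assumes "min_sv_mult n s = 1" and "j \<in> {1..n}" and "s j = s n"
  shows "j = n"
proof -
  have "j \<in> {j \<in> {1..n}. s j = s n}" "n \<in> {j \<in> {1..n}. s j = s n}"
    using assms(2,3) by auto
  then show ?thesis
    using assms(1) unfolding min_sv_mult_def by (metis card_1_singletonE singletonD)
qed

lemma min_sv_mult_neq_1D:
  assumes s: "antimono_on {1..n} s" and "n \<ge> 1" and "min_sv_mult n s \<noteq> 1"
  shows "n \<ge> 2" and "s (n - 1) = s n"
proof -
  let ?S = "{j \<in> {1..n}. s j = s n}"
  have "?S \<noteq> {n}"
  proof
    assume "?S = {n}"
    then have "card ?S = 1"
      by simp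
    then show False
      using assms(3) by (simp only: min_sv_mult_def)
  qed
  moreover have "n \<in> ?S"
    using \<open>n \<ge> 1\<close> by simp
  ultimately have "\<exists>j\<in>?S. j \<noteq> n"
    by blast
  then obtain j where j: "j \<in> {1..n}" "s j = s n" "j < n"
    by auto
  then show "n \<ge> 2"
    by auto
  have "s n \<le> s (n - 1)" "s (n - 1) \<le> s j"
    using monotone_onD [OF s, of "n - 1" n] monotone_onD [OF s, of j "n - 1"] j by auto
  then show "s (n - 1) = s n"
    using j by simp
qed

text \<open>Only the last coordinate of a minimizing vector survives, since every other coordinate
  is stretched by more than \<open>s\<^sub>n\<close>.\<close>
lemma simple_min_sv_vector:
  fixes A :: "complex^'n^'n::finite"
  assumes svd: "is_svd A s u v" and "min_sv_mult CARD('n) s = 1"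
    and le: "norm (A *v x) \<le> s CARD('n) * norm x"
  shows "x = cinner x (v CARD('n)) *s v CARD('n)"
proof -
  let ?n = "CARD('n)"
  let ?g = "\<lambda>j. ((s j)\<^sup>2 - (s ?n)\<^sup>2) * (cmod (cinner x (v j)))\<^sup>2"
  have less: "s ?n < s j" if "j \<in> {1..?n}" "j \<noteq> ?n" for j
    using that is_svdD(6) [OF svd that(1)] min_sv_mult_eq_1D [OF assms(2) that(1)] by fastforce
  have sn: "s ?n \<ge> 0"
    using is_svdD(4) [OF svd] by simp
  have "(norm (A *v x))\<^sup>2 \<le> (s ?n * norm x)\<^sup>2"
    by (rule power_mono [OF le]) simp
  then have "(\<Sum>j=1..?n. ?g j) \<le> 0"
    by (simp add: norm_svd_mult_vec [OF svd] parseval [OF is_svdD(2) [OF svd], of x] power_mult_distrib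
        sum_distrib_left left_diff_distrib sum_subtractf)
  moreover have nonneg: "?g j \<ge> 0" if "j \<in> {1..?n}" for j
    using is_svdD(6) [OF svd that] sn by (simp add: power_mono)
  ultimately have "(\<Sum>j=1..?n. ?g j) = 0"
    by (intro antisym sum_nonneg)
  then have "?g j = 0" if "j \<in> {1..?n}" for j
    using nonneg that by (subst (asm) sum_nonneg_eq_0_iff) auto
  moreover have "(s j)\<^sup>2 - (s ?n)\<^sup>2 \<noteq> 0" if "j \<in> {1..?n}" "j \<noteq> ?n" for j
    using power_strict_mono [OF less [OF that] sn, of 2] by simp
  ultimately have "cinner x (v j) = 0" if "j \<in> {1..?n}" "j \<noteq> ?n" for j
    using that by (metis mult_eq_0_iff norm_eq_zero power_eq_0_iff zero_neq_numeral)
  then have "(\<Sum>j=1..?n. cinner x (v j) *s v j) = (\<Sum>j\<in>{?n}. cinner x (v j) *s v j)"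
    by (intro sum.mono_neutral_right) auto
  then show ?thesis
    using orthonormal_expansion [OF is_svdD(2) [OF svd], of x] by simp
qed

section \<open>Removing the smallest singular values\<close>

lemma cols_prod_mult_vec: "cols_prod a b u v *v x = (\<Sum>j=a..b. cinner x (v j) *s u j)"
proof -
  have "cols_prod a b u v = (\<Sum>j=a..b. outer (u j) (v j))"
    by (simp add: vec_eq_iff cols_prod_def outer_def)
  then show ?thesis
    by (simp add: sum_mult_vec outer_mult_vec)
qed

lemma spectral_norm_cols_prod:
  fixes u v :: "nat \<Rightarrow> complex^'n::finite"
  assumes u: "orthonormal_basis u" and v: "orthonormal_basis v" and a: "1 \<le> a" "a \<le> CARD('n)"
  shows "spectral_norm (cols_prod a CARD('n) u v) = 1"
proof (rule antisym)
  let ?n = "CARD('n)"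
  have S: "{a..?n} \<subseteq> {1..?n}"
    using a by auto
  have "norm (cols_prod a ?n u v *v x) \<le> 1 * norm x" for x
  proof (rule power2_le_imp_le)
    have "(norm (cols_prod a ?n u v *v x))\<^sup>2 = (\<Sum>j=a..?n. (cmod (cinner x (v j)))\<^sup>2)"
      by (simp add: cols_prod_mult_vec norm_orthonormal_sum [OF u S])
    also have "\<dots> \<le> (1 * norm x)\<^sup>2"
      unfolding mult_1 parseval [OF v] by (rule sum_mono2) (use S in auto)
    finally show "(norm (cols_prod a ?n u v *v x))\<^sup>2 \<le> (1 * norm x)\<^sup>2" .
  qed simp
  then show "spectral_norm (cols_prod a ?n u v) \<le> 1"
    by (rule spectral_norm_le)
  have n: "?n \<in> {1..?n}"
    by simp
  have "cols_prod a ?n u v *v v ?n = (\<Sum>j\<in>{?n}. cinner (v ?n) (v j) *s u j)"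
    unfolding cols_prod_mult_vec
    using a S orthonormal_basisD(1) [OF v n] by (intro sum.mono_neutral_right) auto
  then have "cols_prod a ?n u v *v v ?n = u ?n"
    using orthonormal_basisD(1) [OF v n n] by simp
  then show "1 \<le> spectral_norm (cols_prod a ?n u v)"
    using norm_mult_vec_le [of "cols_prod a ?n u v" "v ?n"] orthonormal_basisD(2) [OF v n]
      orthonormal_basisD(2) [OF u n] by simp
qed

text \<open>\<open>E_hat\<close> and \<open>E_tilde\<close> both have the form \<open>-s\<^sub>n [u\<^sub>a \<dots> u\<^sub>n] [v\<^sub>a \<dots> v\<^sub>n]\<^sup>*\<close>; adding it to the matrix lowers
  the singular values from the \<open>a\<close>-th on by \<open>s\<^sub>n\<close>.\<close>
definition lowering :: "nat \<Rightarrow> (nat \<Rightarrow> real) \<Rightarrow> (nat \<Rightarrow> complex^'n) \<Rightarrow> (nat \<Rightarrow> complex^'n) \<Rightarrow> complex^'n^'n::finite" where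
  "lowering a s u v = cscale (- complex_of_real (s CARD('n))) (cols_prod a CARD('n) u v)"

lemma E_hat_eq_lowering: "E_hat s u v = lowering 1 s u v"
  by (simp add: E_hat_def lowering_def Let_def)

lemma E_tilde_eq_lowering:
  fixes u v :: "nat \<Rightarrow> complex^'n::finite"
  shows "E_tilde s u v = lowering (CARD('n) - min_sv_mult CARD('n) s + 1) s u v"
  by (simp add: E_tilde_def lowering_def Let_def)

text \<open>These numbers need not decrease in \<open>j\<close>, so that the lowered matrix is described by its diagonal form in the
  bases \<open>u\<close> and \<open>v\<close> and not by \<open>is_svd\<close>.\<close>
definition lowered_sv :: "nat \<Rightarrow> nat \<Rightarrow> (nat \<Rightarrow> real) \<Rightarrow> nat \<Rightarrow> real" where
  "lowered_sv n a s j = (if a \<le> j then s j - s n else s j)"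

lemma lowered_mult_vec:
  fixes A :: "complex^'n^'n::finite"
  assumes svd: "is_svd A s u v" and a: "1 \<le> a"
  shows "(A + lowering a s u v) *v x
    = (\<Sum>j=1..CARD('n). (lowered_sv CARD('n) a s j * cinner x (v j)) *s u j)"
proof -
  let ?n = "CARD('n)"
  have "(\<Sum>j=a..?n. cinner x (v j) *s u j) = (\<Sum>j=1..?n. (if a \<le> j then cinner x (v j) else 0) *s u j)"
    using a by (intro sum.mono_neutral_cong_left) auto
  then have "(A + lowering a s u v) *v x = (\<Sum>j=1..?n. (s j * cinner x (v j)) *s u j
      + (- complex_of_real (s ?n)) *s ((if a \<le> j then cinner x (v j) else 0) *s u j))"
    unfolding sum.distrib
    by (simp add: matrix_vector_mult_add_rdistrib svd_mult_vec [OF svd] lowering_def cscale_mult_vec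
        cols_prod_mult_vec vec.scale_sum_right)
  also have "\<dots> = (\<Sum>j=1..?n. (lowered_sv ?n a s j * cinner x (v j)) *s u j)"
    by (intro sum.cong) (auto simp: lowered_sv_def vec_eq_iff algebra_simps)
  finally show ?thesis .
qed

lemma cinner_lowered_mult_vec:
  fixes A :: "complex^'n^'n::finite"
  assumes "is_svd A s u v" and "1 \<le> a" and "l \<in> {1..CARD('n)}"
  shows "cinner ((A + lowering a s u v) *v x) (u l)
    = lowered_sv CARD('n) a s l * cinner x (v l)"
  unfolding lowered_mult_vec [OF assms(1,2)]
  by (subst cinner_orthonormal_sum [OF is_svdD(1) [OF assms(1)] order_refl assms(3)])
     (use assms(3) in auto)

lemma lowered_kernel:
  fixes A :: "complex^'n^'n::finite"
  assumes svd: "is_svd A s u v" and "1 \<le> a" "a \<le> CARD('n)"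
  shows "(A + lowering a s u v) *v v CARD('n) = 0"
proof -
  have "(lowered_sv CARD('n) a s j * cinner (v CARD('n)) (v j)) *s u j = 0"
    if "j \<in> {1..CARD('n)}" for j
  proof (cases "j = CARD('n)")
    case False
    then have "cinner (v CARD('n)) (v j) = 0"
      using orthonormal_basisD(1) [OF is_svdD(2) [OF svd] _ that, of "CARD('n)"] by simp
    then show ?thesis
      by simp
  qed (use assms(3) in \<open>simp add: lowered_sv_def\<close>)
  then show ?thesis
    unfolding lowered_mult_vec [OF assms(1,2)] by (intro sum.neutral) blast
qed

lemma lowered_kernel_simple:
  fixes A :: "complex^'n^'n::finite"
  assumes svd: "is_svd A s u v" and a: "1 \<le> a" "a \<le> CARD('n)"
    and pos: "s CARD('n) > 0" and simple: "min_sv_mult CARD('n) s = 1"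
  shows "{x. (A + lowering a s u v) *v x = 0} = vec.span {v CARD('n)}"
proof (intro equalityI subsetI)
  let ?n = "CARD('n)"
  fix x assume "x \<in> {x. (A + lowering a s u v) *v x = 0}"
  then have zero: "lowered_sv ?n a s j * cinner x (v j) = 0" if "j \<in> {1..?n}" for j
    using cinner_lowered_mult_vec [OF svd a(1) that, of x] by simp
  have "cinner x (v j) = 0" if "j \<in> {1..?n}" "j \<noteq> ?n" for j
    using zero [OF that(1)] that pos is_svdD(6) [OF svd that(1)]
      min_sv_mult_eq_1D [OF simple that(1)] by (auto simp: lowered_sv_def split: if_splits)
  then have "(\<Sum>j=1..?n. cinner x (v j) *s v j) = (\<Sum>j\<in>{?n}. cinner x (v j) *s v j)"
    by (intro sum.mono_neutral_right) auto
  then have "x = cinner x (v ?n) *s v ?n"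
    using orthonormal_expansion [OF is_svdD(2) [OF svd], of x] by simp
  then show "x \<in> vec.span {v ?n}"
    by (metis vec.span_base vec.span_scale singletonI)
next
  fix x assume "x \<in> vec.span {v CARD('n)}"
  then obtain c where "x = c *s v CARD('n)"
    by (auto simp: vec.span_singleton)
  then show "x \<in> {x. (A + lowering a s u v) *v x = 0}"
    using lowered_kernel [OF svd a] by (simp add: vec.scale)
qed

text \<open>If \<open>s\<^sub>n\<close> is multiple, the left kernel of the lowered matrix contains \<open>u\<^sub>n\<close> and \<open>u\<^sub>n\<^sub>-\<^sub>1\<close>, and some nonzero
  combination of these two is orthogonal to the given vector \<open>Q'(\<mu>)v\<^sub>n\<close>. If \<open>s\<^sub>n\<close> is simple, the left kernel is a
  line, and the orthogonality has to be assumed.\<close>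
lemma lowered_double_zero:
  fixes Q :: "'n::finite matpoly"
  assumes svd: "is_svd A s u v" and a: "1 \<le> a" "a \<le> CARD('n) - min_sv_mult CARD('n) s + 1"
    and Q: "mp_eval Q \<mu> = A + lowering a s u v"
    and simple: "min_sv_mult CARD('n) s = 1 \<Longrightarrow>
      cinner (mp_eval (mp_deriv Q) \<mu> *v v CARD('n)) (u CARD('n)) = 0"
  shows "[:-\<mu>, 1:]\<^sup>2 dvd det Q"
proof -
  let ?n = "CARD('n)"
  define y where "y = mp_eval (mp_deriv Q) \<mu> *v v ?n"
  have n: "?n \<in> {1..?n}"
    by simp
  have an: "a \<le> ?n"
    using a(2) min_sv_mult_ge_1 [of ?n s] n unfolding atLeastAtMost_iff by arith
  have left: "cinner (mp_eval Q \<mu> *v x) (u l) = 0" if "l \<in> {1..?n}" "a \<le> l" "s l = s ?n" for x l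
    using cinner_lowered_mult_vec [OF svd a(1) that(1), of x] that by (simp add: Q lowered_sv_def)
  have "\<exists>u'. u' \<noteq> 0 \<and> (\<forall>x. cinner (mp_eval Q \<mu> *v x) u' = 0) \<and> cinner y u' = 0"
  proof (cases "cinner y (u ?n) = 0")
    case True
    then show ?thesis
      using left [OF n an] orthonormal_basisD(3) [OF is_svdD(1) [OF svd] n] by blast
  next
    case False
    then have k: "min_sv_mult ?n s \<noteq> 1"
      using simple by (auto simp: y_def)
    have n1: "2 \<le> ?n" "s (?n - 1) = s ?n"
      using min_sv_mult_neq_1D [OF is_svdD(3) [OF svd] _ k] n by auto
    have mem: "?n - 1 \<in> {1..?n}" "?n - 1 \<noteq> ?n" "a \<le> ?n - 1"
      using n1 a(2) k min_sv_mult_ge_1 [of ?n s] by auto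
    define u' where "u' = cnj (cinner y (u (?n - 1))) *s u ?n + (- cnj (cinner y (u ?n))) *s u (?n - 1)"
    have "cinner u' (u (?n - 1)) = - cnj (cinner y (u ?n))"
      using orthonormal_basisD(1) [OF is_svdD(1) [OF svd] mem(1) mem(1)]
        orthonormal_basisD(1) [OF is_svdD(1) [OF svd] n mem(1)] mem(2)
      by (simp only: u'_def cinner_add_left cinner_scale_left) simp
    then have "u' \<noteq> 0"
      using False by auto
    moreover have "cinner (mp_eval Q \<mu> *v x) u' = 0" for x
      using left [OF n an] left [OF mem(1) mem(3) n1(2)]
      by (simp only: u'_def cinner_add_right cinner_scale_right) simp
    moreover have "cinner y u' = 0"
      by (simp only: u'_def cinner_add_right cinner_scale_right) simp
    ultimately show ?thesis
      by blast
  qed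
  then obtain u' where "u' \<noteq> 0" "\<And>x. cinner (mp_eval Q \<mu> *v x) u' = 0" "cinner y u' = 0"
    by blast
  then show ?thesis
    using double_zero_det [of "v ?n" Q \<mu> u'] orthonormal_basisD(3) [OF is_svdD(2) [OF svd] n]
      lowered_kernel [OF svd a(1) an] by (simp add: Q y_def)
qed


section \<open>Existence of singular value decompositions\<close>

text \<open>A vector orthogonal to fewer than \<open>n\<close> given ones exists because a square
  matrix with a zero row is singular.\<close>
lemma ex_unit_orthogonal:
  fixes v :: "nat \<Rightarrow> complex^'n::finite"
  assumes "j \<le> CARD('n)"
  shows "\<exists>x. norm x = 1 \<and> (\<forall>i\<in>{1..<j}. cinner x (v i) = 0)"
proof (cases "j = 0")
  case True
  then show ?thesis
    by (intro exI [of _ "axis undefined 1"]) simp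
next
  case False
  have "card (UNIV :: 'n set) = card {1..CARD('n)}"
    by simp
  then obtain b :: "'n \<Rightarrow> nat" where b: "bij_betw b UNIV {1..CARD('n)}"
    by (metis finite finite_atLeastAtMost finite_same_card_bij)
  define V :: "complex^'n^'n" where "V = (\<chi> k i. if b k < j then cnj (v (b k) $ i) else 0)"
  have "j \<in> range b"
    using b False assms by (simp add: bij_betw_def)
  then obtain k where "b k = j"
    by blast
  then have "row k V = 0"
    by (simp add: row_def V_def vec_eq_iff)
  then have "det V = 0"
    by (rule det_zero_row(1))
  then have "\<not> (\<forall>x. V *v x = 0 \<longrightarrow> x = 0)"
    by (metis invertible_det_nz invertible_left_inverse matrix_left_invertible_ker)
  then obtain a where a: "V *v a = 0" "a \<noteq> 0"
    by blast
  have orth: "cinner a (v i) = 0" if i: "i \<in> {1..<j}" for i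
  proof -
    have "i \<in> range b"
      using b i assms by (simp add: bij_betw_def)
    then obtain l where l: "b l = i"
      by blast
    have "(V *v a) $ l = cinner a (v i)"
      using i l by (simp add: V_def matrix_vector_mult_def cinner_def mult.commute)
    then show ?thesis
      using a(1) by simp
  qed
  show ?thesis
    by (rule exI [of _ "complex_of_real (inverse (norm a)) *s a"])
       (use a(2) orth in \<open>simp add: norm_cscale norm_inverse cinner_scale_left\<close>)
qed

text \<open>Test with \<open>c\<close> equal to the conjugate of \<open>\<langle>Ay, Av\<rangle>\<close> over \<open>s\<^sup>2\<close>: the linear term in \<open>c\<close> beats the quadratic one.\<close>
lemma cinner_images_eq_0:
  fixes A :: "complex^'n^'n::finite"
  assumes s: "norm (A *v v) = s" "s > 0"
    and bound: "\<And>c. (norm (A *v (v + c *s y)))\<^sup>2 \<le> s\<^sup>2 * (1 + (cmod c)\<^sup>2)"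
  shows "cinner (A *v y) (A *v v) = 0"
proof -
  define h where "h = cinner (A *v y) (A *v v)"
  define c where "c = cnj h / complex_of_real (s\<^sup>2)"
  have ch: "Re (c * h) = (cmod h)\<^sup>2 / s\<^sup>2"
  proof -
    have "c * h = complex_of_real ((cmod h)\<^sup>2 / s\<^sup>2)"
      by (simp add: c_def complex_norm_square [symmetric] mult.commute [of "cnj _"])
    then show ?thesis
      by (simp only: Re_complex_of_real)
  qed
  have "(norm (A *v (v + c *s y)))\<^sup>2 = s\<^sup>2 + 2 * Re (c * h) + (norm (A *v (c *s y)))\<^sup>2"
    by (simp add: matrix_vector_right_distrib vec.scale h_def s(1) [symmetric] cinner_scale_left [symmetric]
        Re_cinner power2_norm_eq_inner inner_simps inner_commute)
  then have "2 * Re (c * h) \<le> s\<^sup>2 * (cmod c)\<^sup>2"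
    using bound [of c] zero_le_power2 [of "norm (A *v (c *s y))"] unfolding distrib_left by linarith
  also have "\<dots> = (cmod h)\<^sup>2 / s\<^sup>2"
    using s(2) by (simp add: c_def norm_divide norm_mult power_divide power2_eq_square)
  finally have "(cmod h)\<^sup>2 / s\<^sup>2 \<le> 0"
    unfolding ch by linarith
  then show ?thesis
    using s(2) by (simp add: h_def divide_le_0_iff)
qed

text \<open>Choose \<open>v\<^sub>j\<close> greedily as a maximizer of \<open>\<parallel>Ax\<parallel>\<close> over the unit vectors orthogonal to
  \<open>v\<^sub>1, \<dots>, v\<^sub>j\<^sub>-\<^sub>1\<close>. Maximality makes the images \<open>Av\<^sub>j\<close> orthogonal, and they are nonzero since \<open>A\<close> is injective.\<close>
lemma svd_exists:
  fixes A :: "complex^'n^'n::finite"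
  assumes inj: "\<And>x. A *v x = 0 \<Longrightarrow> x = 0"
  shows "\<exists>s u v. is_svd A s u v"
proof -
  let ?n = "CARD('n)"
  define F where "F v j = {x. norm x = 1 \<and> (\<forall>i\<in>{1..<j}. cinner x (v i) = 0)}" for v :: "nat \<Rightarrow> complex^'n" and j
  have "\<exists>v. \<forall>j. j \<le> ?n \<longrightarrow> v j \<in> F v j \<and> (\<forall>x\<in>F v j. norm (A *v x) \<le> norm (A *v v j))"
  proof (rule dependent_wellorder_choice)
    fix r j and f g :: "nat \<Rightarrow> complex^'n"
    assume "\<And>i. i < j \<Longrightarrow> f i = g i"
    then have "F f j = F g j"
      by (auto simp: F_def)
    then show "(j \<le> ?n \<longrightarrow> r \<in> F f j \<and> (\<forall>x\<in>F f j. norm (A *v x) \<le> norm (A *v r)))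
        = (j \<le> ?n \<longrightarrow> r \<in> F g j \<and> (\<forall>x\<in>F g j. norm (A *v x) \<le> norm (A *v r)))"
      by simp
  next
    fix j and f :: "nat \<Rightarrow> complex^'n"
    have "continuous_on UNIV (\<lambda>x. cinner x y)" for y :: "complex^'n"
      unfolding cinner_def by (intro continuous_intros)
    then have "closed {x. cinner x y = 0}" for y :: "complex^'n"
      by (intro closed_Collect_eq) auto
    then have "closed (\<Inter>i\<in>{1..<j}. {x. cinner x (f i) = 0})"
      by blast
    then have "compact (sphere 0 1 \<inter> (\<Inter>i\<in>{1..<j}. {x. cinner x (f i) = 0}))"
      by (intro compact_Int_closed) auto
    also have "sphere 0 1 \<inter> (\<Inter>i\<in>{1..<j}. {x. cinner x (f i) = 0}) = F f j"
      by (auto simp: F_def)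
    finally have "compact (F f j)" .
    moreover have "continuous_on (F f j) (\<lambda>x. norm (A *v x))"
      by (intro continuous_intros linear_continuous_on) simp
    moreover have "F f j \<noteq> {}" if "j \<le> ?n"
      using ex_unit_orthogonal [OF that, of f] by (auto simp: F_def)
    ultimately show "\<exists>r. j \<le> ?n \<longrightarrow> r \<in> F f j \<and> (\<forall>x\<in>F f j. norm (A *v x) \<le> norm (A *v r))"
      using continuous_attains_sup [of "F f j" "\<lambda>x. norm (A *v x)"] by blast
  qed
  then obtain v where v: "\<And>j. j \<le> ?n \<Longrightarrow> v j \<in> F v j"
    and max: "\<And>j x. j \<le> ?n \<Longrightarrow> x \<in> F v j \<Longrightarrow> norm (A *v x) \<le> norm (A *v v j)"
    by blast
  define s where "s j = norm (A *v v j)" for j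
  define u where "u j = complex_of_real (inverse (s j)) *s (A *v v j)" for j
  have unit: "norm (v j) = 1" if "j \<le> ?n" for j
    using v [OF that] by (simp add: F_def)
  then have self: "cinner (v j) (v j) = 1" if "j \<le> ?n" for j
    using that by (simp add: cinner_self)
  have pos: "s j > 0" if "j \<le> ?n" for j
    using inj [of "v j"] unit [OF that] by (auto simp: s_def)
  have orth: "cinner (v j) (v i) = 0" if "1 \<le> i" "i < j" "j \<le> ?n" for i j
    using v [of j] that by (simp add: F_def)
  have orth_im: "cinner (A *v v j) (A *v v i) = 0" if ij: "1 \<le> i" "i < j" "j \<le> ?n" for i j
  proof (rule cinner_images_eq_0)
    have i: "i \<le> ?n"
      using ij by simp
    show "norm (A *v v i) = s i" "s i > 0"
      using pos [OF i] by (simp_all add: s_def)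
    fix c
    define x where "x = v i + c *s v j"
    have ji: "cinner (v i) (v j) = 0"
      using orth [OF ij] cnj_cinner [of "v j" "v i"] by simp
    have "complex_of_real ((norm x)\<^sup>2) = complex_of_real (1 + (cmod c)\<^sup>2)"
      unfolding cinner_self [symmetric] x_def
      by (simp add: cinner_add_left cinner_add_right cinner_scale_left cinner_scale_right orth [OF ij] ji
          self [OF i] self [OF ij(3)] complex_norm_square [symmetric] mult.commute [of "cnj _"])
    then have x: "(norm x)\<^sup>2 = 1 + (cmod c)\<^sup>2"
      by (simp only: of_real_eq_iff)
    then have "norm x \<noteq> 0"
      by (metis add_nonneg_pos less_irrefl norm_zero power_zero_numeral zero_le_power2 zero_less_one add.commute)
    moreover have "cinner x (v k) = 0" if "k \<in> {1..<i}" for k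
      using v [OF i] v [OF ij(3)] ij that by (simp add: F_def x_def cinner_scale_left cinner_add_left)
    ultimately have "complex_of_real (inverse (norm x)) *s x \<in> F v i"
      by (simp add: F_def norm_cscale norm_inverse cinner_scale_left)
    from max [OF i this] have "norm (A *v x) \<le> s i * norm x"
      using \<open>norm x \<noteq> 0\<close> by (simp add: vec.scale norm_cscale norm_inverse norm_divide s_def field_simps)
    then have "(norm (A *v x))\<^sup>2 \<le> (s i * norm x)\<^sup>2"
      by (rule power_mono) simp
    then show "(norm (A *v (v i + c *s v j)))\<^sup>2 \<le> (s i)\<^sup>2 * (1 + (cmod c)\<^sup>2)"
      by (simp add: power_mult_distrib x) (simp add: x_def)
  qed
  have "cinner (v i) (v j) = (if i = j then 1 else 0)" if "i \<in> {1..?n}" "j \<in> {1..?n}" for i j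
    using that orth [of i j] orth [of j i] cnj_cinner [of "v j" "v i"] unit [of i]
    by (cases i j rule: linorder_cases) (auto simp: cinner_self)
  moreover have "cinner (u i) (u j) = (if i = j then 1 else 0)" if "i \<in> {1..?n}" "j \<in> {1..?n}" for i j
  proof -
    have "cinner (A *v v i) (A *v v j) = (if i = j then complex_of_real ((s i)\<^sup>2) else 0)"
      using that orth_im [of i j] orth_im [of j i] cnj_cinner [of "A *v v j" "A *v v i"]
      by (cases i j rule: linorder_cases) (auto simp: cinner_self s_def)
    then show ?thesis
      using pos [of i] that
      by (cases "i = j") (simp_all add: u_def cinner_scale_left cinner_scale_right power2_eq_square field_simps)
  qed
  moreover have "antimono_on {1..?n} s"
  proof (rule monotone_onI)
    fix i j assume "i \<in> {1..?n}" "j \<in> {1..?n}" "i \<le> j"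
    then have "v j \<in> F v i" "i \<le> ?n"
      using v [of j] by (auto simp: F_def)
    then show "s j \<le> s i"
      unfolding s_def by (intro max)
  qed
  moreover have "s j \<ge> 0" "A *v v j = complex_of_real (s j) *s u j" if "j \<in> {1..?n}" for j
    using pos [of j] that by (simp_all add: u_def vector_smult_assoc)
  ultimately have "is_svd A s u v"
    by (simp add: is_svd_def orthonormal_basis_def)
  then show ?thesis
    by blast
qed


section \<open>Singular values at a meeting point\<close>

lemma poly_0_pderiv: "poly (pderiv w) 0 = coeff w 1"
  by (simp add: poly_0_coeff_0 coeff_pderiv)

text \<open>At \<open>\<mu>\<close> the minimum is attained exactly on the level \<open>\<epsilon>\<close>, and for simple \<open>s\<^sub>n\<close> every test vector is a
  multiple of \<open>v\<^sub>n\<close>; so the absence of a descent direction turns into a statement about \<open>u\<^sub>n\<^sup>*P'(\<mu>)v\<^sub>n\<close> alone. The weight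
  is continued along the phases \<open>\<theta>\<close> of \<open>\<mu>\<close>; for \<open>\<mu> \<noteq> 0\<close> there is only one of them, while at the
  origin every unimodular \<open>\<theta>\<close> occurs, reflecting the cone-shaped singularity of \<open>w(\<bar>z\<bar>)\<close> there.\<close>
lemma meeting_point_svd:
  fixes P :: "nat \<Rightarrow> complex^'n^'n::finite"
  assumes w: "weight_poly m w" and "\<epsilon> > 0" and meet: "components_meet m P w \<epsilon> G1 G2 \<mu>"
    and svd: "is_svd (mp_eval (matpoly m P) \<mu>) s u v"
  shows "s CARD('n) = \<epsilon> * poly w (cmod \<mu>)" and "s CARD('n) > 0"
    and "min_sv_mult CARD('n) s = 1 \<Longrightarrow>
      \<exists>\<theta>::complex. cmod \<theta> = 1 \<and> \<theta> * \<mu> = complex_of_real (cmod \<mu>) \<and>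
        Re (d * (cinner (mp_eval (mp_deriv (matpoly m P)) \<mu> *v v CARD('n)) (u CARD('n))
          - \<epsilon> * \<theta> * complex_of_real (poly (pderiv w) (cmod \<mu>)))) \<ge> 0"
proof -
  let ?Q = "matpoly m P"
  let ?n = "CARD('n)"
  let ?A = "mp_eval ?Q \<mu>" and ?B = "mp_eval (mp_deriv ?Q) \<mu>"
  let ?W = "poly w (cmod \<mu>)" and ?W' = "poly (pderiv w) (cmod \<mu>)"
  have n: "?n \<in> {1..?n}"
    by simp
  have vn: "norm (v ?n) = 1" and un: "norm (u ?n) = 1"
    using orthonormal_basisD(2) [OF is_svdD(2) [OF svd] n] orthonormal_basisD(2) [OF is_svdD(1) [OF svd] n]
    by auto
  have Avn: "?A *v v ?n = complex_of_real (s ?n) *s u ?n"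
    by (rule is_svdD(5) [OF svd n])
  have W: "?W > 0"
    by (rule weight_poly_pos [OF w]) simp
  obtain x where x: "norm x = 1" "norm (?A *v x) \<le> \<epsilon> * ?W"
    using components_meet_not_joined(1) [OF w meet] by (auto simp: sublevel_def)
  have "s ?n \<le> \<epsilon> * ?W"
    using min_sv_le [OF svd, of x] x by simp
  moreover have "\<epsilon> * ?W \<le> s ?n"
    using components_meet_boundary [OF w meet] vn is_svdD(4) [OF svd n]
    by (auto simp: strict_sublevel_def Avn norm_cscale un not_less dest!: spec [of _ "v ?n"])
  ultimately show sn: "s ?n = \<epsilon> * ?W"
    by simp
  then show pos: "s ?n > 0"
    using W \<open>\<epsilon> > 0\<close> by simp
  assume simple: "min_sv_mult ?n s = 1"
  define g where "g = cinner (?B *v v ?n) (u ?n)"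
  obtain x \<theta> where x: "norm x = 1" "norm (?A *v x) \<le> \<epsilon> * ?W"
    and \<theta>: "cmod \<theta> = 1" "\<theta> * \<mu> = complex_of_real (cmod \<mu>)"
    and rate: "descent_rate ?Q w \<epsilon> d \<mu> x \<theta> \<ge> 0"
    using no_descent_direction [OF w meet \<open>\<epsilon> > 0\<close>, of d] by blast
  define c where "c = cinner x (v ?n)"
  have xc: "x = c *s v ?n"
    unfolding c_def by (rule simple_min_sv_vector [OF svd simple]) (use x sn in simp)
  have c: "c * cnj c = 1"
    using x(1) vn by (simp add: xc norm_cscale complex_norm_square [symmetric])
  have "inner (?A *v x) (d *s (?B *v x)) = Re (cinner (d *s (?B *v x)) (?A *v x))"
    by (simp add: Re_cinner inner_commute)
  also have "cinner (d *s (?B *v x)) (?A *v x) = (c * cnj c) * (s ?n * (d * g))"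
    by (simp add: xc vec.scale Avn cinner_scale_left cinner_scale_right g_def mult_ac)
  also have "Re \<dots> = s ?n * Re (d * g)"
    by (simp only: c mult_1 Re_complex_of_real times_complex.simps Im_complex_of_real)
  finally have stretch: "inner (?A *v x) (d *s (?B *v x)) = s ?n * Re (d * g)" .
  have "\<epsilon>\<^sup>2 * inner (poly (cpoly w) (\<theta> * \<mu>)) (d * (\<theta> * poly (pderiv (cpoly w)) (\<theta> * \<mu>)))
      = s ?n * Re (d * (\<epsilon> * \<theta> * complex_of_real ?W'))"
    by (simp only: \<theta>(2) pderiv_cpoly poly_cpoly)
       (simp add: inner_complex_def sn power2_eq_square algebra_simps)
  with stretch have "descent_rate ?Q w \<epsilon> d \<mu> x \<theta> = s ?n * Re (d * g) - s ?n * Re (d * (\<epsilon> * \<theta> * complex_of_real ?W'))"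
    by (simp only: descent_rate_def)
  also have "\<dots> = s ?n * Re (d * (g - \<epsilon> * \<theta> * complex_of_real ?W'))"
    by (simp only: right_diff_distrib minus_complex.simps)
  finally have "Re (d * (g - \<epsilon> * \<theta> * complex_of_real ?W')) \<ge> 0"
    using rate pos by (simp add: zero_le_mult_iff)
  then show "\<exists>\<theta>::complex. cmod \<theta> = 1 \<and> \<theta> * \<mu> = complex_of_real (cmod \<mu>) \<and>
        Re (d * (cinner (?B *v v ?n) (u ?n) - \<epsilon> * \<theta> * complex_of_real ?W')) \<ge> 0"
    using \<theta> unfolding g_def by blast
qed

text \<open>Both parts take for \<open>d\<close> the direction of steepest descent. For \<open>\<mu> \<noteq> 0\<close> the phase is unique and the
  expression must vanish; for \<open>\<mu> = 0\<close> the phase may depend on \<open>d\<close>, which leaves an inequality.\<close>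
lemma meeting_point_simple:
  fixes P :: "nat \<Rightarrow> complex^'n^'n::finite"
  assumes w: "weight_poly m w" and "\<epsilon> > 0" and meet: "components_meet m P w \<epsilon> G1 G2 \<mu>"
    and svd: "is_svd (mp_eval (matpoly m P) \<mu>) s u v" and simple: "min_sv_mult CARD('n) s = 1"
  defines "g \<equiv> cinner (mp_eval (mp_deriv (matpoly m P)) \<mu> *v v CARD('n)) (u CARD('n))"
  shows "\<mu> \<noteq> 0 \<Longrightarrow> g = \<epsilon> * (cnj \<mu> / cmod \<mu>) * complex_of_real (poly (pderiv w) (cmod \<mu>))"
    and "\<mu> = 0 \<Longrightarrow> cmod g \<le> \<epsilon> * coeff w 1"
proof -
  assume "\<mu> \<noteq> 0"
  define h where "h = g - \<epsilon> * (cnj \<mu> / cmod \<mu>) * complex_of_real (poly (pderiv w) (cmod \<mu>))"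
  have \<theta>: "\<theta> = cnj \<mu> / cmod \<mu>" if "\<theta> * \<mu> = complex_of_real (cmod \<mu>)" for \<theta>
  proof -
    have "\<theta> * (\<mu> * cnj \<mu>) = complex_of_real (cmod \<mu>) * cnj \<mu>"
      using that by (simp add: mult.assoc [symmetric])
    then show ?thesis
      using \<open>\<mu> \<noteq> 0\<close> by (simp add: complex_norm_square [symmetric] power2_eq_square field_simps)
  qed
  have "Re (- cnj h * h) \<ge> 0"
    using meeting_point_svd(3) [OF w \<open>\<epsilon> > 0\<close> meet svd simple, of "- cnj h"] \<theta>
    unfolding h_def g_def by metis
  moreover have "- cnj h * h = - complex_of_real ((cmod h)\<^sup>2)"
    by (simp add: complex_norm_square [symmetric] mult.commute [of "cnj _"])
  ultimately have "(cmod h)\<^sup>2 \<le> 0"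
    by (simp only: uminus_complex.simps Re_complex_of_real neg_0_le_iff_le)
  then show "g = \<epsilon> * (cnj \<mu> / cmod \<mu>) * complex_of_real (poly (pderiv w) (cmod \<mu>))"
    by (simp add: h_def)
next
  assume \<mu>: "\<mu> = 0"
  have w1: "coeff w 1 \<ge> 0"
    by (rule weight_poly_coeff_nonneg [OF w])
  obtain \<theta> :: complex where \<theta>: "cmod \<theta> = 1" "Re (- cnj g * (g - \<epsilon> * \<theta> * complex_of_real (coeff w 1))) \<ge> 0"
    using meeting_point_svd(3) [OF w \<open>\<epsilon> > 0\<close> meet svd simple, of "- cnj g"]
    unfolding g_def \<mu> norm_zero poly_0_pderiv by blast
  have "- cnj g * (g - \<epsilon> * \<theta> * complex_of_real (coeff w 1))
      = cnj g * (\<epsilon> * \<theta> * complex_of_real (coeff w 1)) - complex_of_real ((cmod g)\<^sup>2)"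
    by (simp add: complex_norm_square [symmetric] mult.commute [of "cnj _" g] right_diff_distrib)
  then have "(cmod g)\<^sup>2 \<le> Re (cnj g * (\<epsilon> * \<theta> * complex_of_real (coeff w 1)))"
    using \<theta>(2) by (simp only: minus_complex.simps Re_complex_of_real diff_ge_0_iff_ge)
  also have "\<dots> \<le> cmod (cnj g * (\<epsilon> * \<theta> * complex_of_real (coeff w 1)))"
    by (rule complex_Re_le_cmod)
  also have "\<dots> = cmod g * (\<epsilon> * coeff w 1)"
    using w1 \<open>\<epsilon> > 0\<close> by (simp add: norm_mult \<theta>(1))
  finally show "cmod g \<le> \<epsilon> * coeff w 1"
    using w1 \<open>\<epsilon> > 0\<close> by (cases "g = 0") (simp_all add: power2_eq_square)
qed

section \<open>The perturbations\<close>

text \<open>If a determinant of a perturbation vanished identically, every complex number would be one of its eigenvalues and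
  the pseudospectrum would be the whole plane. The order of the zero at \<open>\<mu>\<close> would then be meaningless.\<close>
lemma det_perturbed_neq_0:
  assumes "pseudospectrum m P w \<epsilon> \<noteq> UNIV" and "Q \<in> pert_boundary m P \<epsilon> w"
  shows "det Q \<noteq> 0"
proof -
  obtain z where "z \<notin> pseudospectrum m P w \<epsilon>"
    using assms(1) by blast
  moreover have "Q \<in> pert_ball m P \<epsilon> w"
    using assms(2) by (auto simp: pert_boundary_def pert_ball_def)
  ultimately have "\<not> eigenvalue Q z"
    by (auto simp: pseudospectrum_def)
  then show ?thesis
    by (auto simp: eigenvalue_def poly_det [symmetric])
qed

abbreviation local_weight :: "real poly \<Rightarrow> complex \<Rightarrow> real poly" where
  "local_weight w \<mu> \<equiv> (if \<mu> = 0 then const_weight w else w)"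

lemma weight_poly_local: "weight_poly m w \<Longrightarrow> weight_poly m (local_weight w \<mu>)"
  by (auto simp: weight_poly_def const_weight_def coeff_pCons split: nat.splits)

lemma poly_local_weight: "poly (local_weight w \<mu>) (cmod \<mu>) = poly w (cmod \<mu>)"
  by (simp add: const_weight_def poly_0_coeff_0)

lemma mp_eval_spread:
  assumes w: "weight_poly m w"
  shows "mp_eval (matpoly m (\<lambda>j. P j + spread w \<mu> E j)) \<mu> = mp_eval (matpoly m P) \<mu> + E"
proof -
  let ?w = "local_weight w \<mu>" and ?\<theta> = "cnj \<mu> / complex_of_real (cmod \<mu>)"
  have "poly ?w (cmod \<mu>) > 0"
    using weight_poly_pos [OF weight_poly_local [OF w]] by simp
  moreover have "?\<theta> * \<mu> = complex_of_real (cmod \<mu>)"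
    by (cases "\<mu> = 0") (simp_all add: complex_norm_square [symmetric] power2_eq_square mult.commute [of "cnj _"])
  ultimately have "poly (cpoly ?w) (?\<theta> * \<mu>) / complex_of_real (poly ?w (cmod \<mu>)) = 1"
    by (simp only: poly_cpoly) simp
  then have "(\<Sum>j\<le>m. cscale (\<mu> ^ j) (spread w \<mu> E j)) = cscale 1 E"
    unfolding spread_def Let_def sum_weighted_phase [OF weight_poly_local [OF w]] by (simp only:)
  then show ?thesis
    by (simp add: mp_eval_perturbed vec_eq_iff)
qed

lemma sum_deriv_weighted_phase:
  assumes "weight_poly m w"
  shows "(\<Sum>j\<le>m. cscale (of_nat j * z ^ (j - 1)) (cscale (\<theta> ^ j * complex_of_real (coeff w j / W)) E))
    = cscale (\<theta> * poly (pderiv (cpoly w)) (\<theta> * z) / complex_of_real W) E"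
proof -
  have "cpoly w = (\<Sum>j\<le>m. monom (complex_of_real (coeff w j)) j)"
  proof (rule poly_eqI)
    fix k
    show "coeff (cpoly w) k = coeff (\<Sum>j\<le>m. monom (complex_of_real (coeff w j)) j) k"
      using assms coeff_eq_0 [of w k] by (auto simp: coeff_map_poly coeff_sum weight_poly_def)
  qed
  then have "poly (pderiv (cpoly w)) (\<theta> * z) = (\<Sum>j\<le>m. of_nat j * complex_of_real (coeff w j) * (\<theta> * z) ^ (j - 1))"
    by (simp add: pderiv_sum pderiv_monom poly_sum poly_monom)
  moreover have shift: "\<theta> * (of_nat j * c * (\<theta> * z) ^ (j - 1)) = of_nat j * z ^ (j - 1) * (\<theta> ^ j * c)" for j c
    by (cases j) (simp_all add: power_mult_distrib mult_ac)
  ultimately have "\<theta> * poly (pderiv (cpoly w)) (\<theta> * z) = (\<Sum>j\<le>m. of_nat j * z ^ (j - 1) * (\<theta> ^ j * complex_of_real (coeff w j)))"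
    by (simp only: sum_distrib_left shift)
  then show ?thesis
    by (simp add: vec_eq_iff sum_divide_distrib sum_distrib_left mult_ac)
qed

lemma mp_eval_deriv_spread:
  assumes w: "weight_poly m w"
  shows "mp_eval (mp_deriv (matpoly m (\<lambda>j. P j + spread w \<mu> E j))) \<mu> = mp_eval (mp_deriv (matpoly m P)) \<mu>
    + cscale (cnj \<mu> / cmod \<mu> * complex_of_real (poly (pderiv w) (cmod \<mu>) / poly w (cmod \<mu>))) E"
proof -
  let ?w = "local_weight w \<mu>" and ?\<theta> = "cnj \<mu> / complex_of_real (cmod \<mu>)"
  have "?\<theta> * \<mu> = complex_of_real (cmod \<mu>)"
    by (cases "\<mu> = 0") (simp_all add: complex_norm_square [symmetric] power2_eq_square mult.commute [of "cnj _"])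
  then have "(\<Sum>j\<le>m. cscale (of_nat j * \<mu> ^ (j - 1)) (spread w \<mu> E j))
      = cscale (?\<theta> * poly (pderiv (cpoly ?w)) (complex_of_real (cmod \<mu>)) / complex_of_real (poly ?w (cmod \<mu>))) E"
    unfolding spread_def Let_def sum_deriv_weighted_phase [OF weight_poly_local [OF w]] by (simp only:)
  also have "\<dots> = cscale (?\<theta> * complex_of_real (poly (pderiv w) (cmod \<mu>) / poly w (cmod \<mu>))) E"
    unfolding poly_local_weight pderiv_cpoly poly_cpoly by (simp add: vec_eq_iff)
  finally show ?thesis
    by (simp add: mp_eval_mp_deriv_matpoly vec_eq_iff distrib_left sum.distrib)
qed

lemma spread_in_pert_boundary:
  assumes w: "weight_poly m w" and E: "spectral_norm E = \<epsilon> * poly w (cmod \<mu>)" and "\<epsilon> > 0"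
  shows "matpoly m (\<lambda>j. P j + spread w \<mu> E j) \<in> pert_boundary m P \<epsilon> (local_weight w \<mu>)"
proof -
  let ?w = "local_weight w \<mu>" and ?\<theta> = "cnj \<mu> / complex_of_real (cmod \<mu>)"
  have W: "poly ?w (cmod \<mu>) > 0"
    using weight_poly_pos [OF weight_poly_local [OF w]] by simp
  have nonneg: "coeff ?w j \<ge> 0" for j
    using weight_poly_coeff_nonneg [OF weight_poly_local [OF w]] by simp
  have norm_eq: "spectral_norm (spread w \<mu> E j) = cmod ?\<theta> ^ j * (\<epsilon> * coeff ?w j)" for j
  proof -
    have "spectral_norm (spread w \<mu> E j)
        = cmod ?\<theta> ^ j * (coeff ?w j / poly ?w (cmod \<mu>)) * (\<epsilon> * poly ?w (cmod \<mu>))"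
      unfolding spread_def Let_def spectral_norm_cscale E poly_local_weight [symmetric, of w]
      using W nonneg [of j] by (simp only: norm_mult norm_power norm_of_real abs_of_nonneg divide_nonneg_pos)
    then show ?thesis
      using W by simp
  qed
  have "cmod ?\<theta> \<le> 1"
    by (simp add: norm_divide)
  then have "cmod ?\<theta> ^ j * (\<epsilon> * coeff ?w j) \<le> 1 * (\<epsilon> * coeff ?w j)" for j
    using nonneg [of j] \<open>\<epsilon> > 0\<close> by (intro mult_right_mono power_le_one) simp_all
  then have "spectral_norm (spread w \<mu> E j) \<le> \<epsilon> * coeff ?w j" for j
    unfolding norm_eq by simp
  moreover have "coeff ?w 0 > 0" "spectral_norm (spread w \<mu> E 0) = \<epsilon> * coeff ?w 0"
    using weight_poly_local [OF w, of \<mu>] by (simp_all add: norm_eq weight_poly_def)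
  ultimately show ?thesis
    unfolding pert_boundary_def by blast
qed

lemma spectral_norm_lowering:
  fixes A :: "complex^'n^'n::finite"
  assumes "is_svd A s u v" and "1 \<le> a" "a \<le> CARD('n)"
  shows "spectral_norm (lowering a s u v) = s CARD('n)"
  using is_svdD(4) [OF assms(1)]
  by (simp add: lowering_def spectral_norm_cscale
      spectral_norm_cols_prod [OF is_svdD(1,2) [OF assms(1)] assms(2,3)])

text \<open>The function \<open>w(\<bar>z\<bar>)\<close> is differentiable at a nonzero \<open>\<mu>\<close>, and everywhere if \<open>w\<close> is constant. In these cases the
  stationarity condition says that \<open>u\<^sub>n\<^sup>*P'(\<mu>)v\<^sub>n\<close> is \<open>\<epsilon>\<close> times the derivative of the weight, and this is exactly
  what the derivative of the spread perturbation subtracts.\<close>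
lemma spread_lowering_multiple:
  fixes P :: "nat \<Rightarrow> complex^'n^'n::finite"
  assumes w: "weight_poly m w" and "\<epsilon> > 0" and meet: "components_meet m P w \<epsilon> G1 G2 \<mu>"
    and proper: "pseudospectrum m P w \<epsilon> \<noteq> UNIV"
    and smooth: "\<mu> \<noteq> 0 \<or> w = const_weight w"
    and svd: "is_svd (mp_eval (matpoly m P) \<mu>) s u v"
    and a: "1 \<le> a" "a \<le> CARD('n) - min_sv_mult CARD('n) s + 1"
  defines "Q \<equiv> matpoly m (\<lambda>j. P j + spread w \<mu> (lowering a s u v) j)"
  shows "Q \<in> pert_boundary m P \<epsilon> w" and "multiple_eigenvalue Q \<mu>"
    and "min_sv_mult CARD('n) s = 1 \<Longrightarrow> geo_mult Q \<mu> = 1"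
proof -
  let ?n = "CARD('n)"
  have n: "?n \<in> {1..?n}"
    by simp
  have an: "a \<le> ?n"
    using a(2) min_sv_mult_ge_1 [of ?n s] n unfolding atLeastAtMost_iff by arith
  note sn = meeting_point_svd(1,2) [OF w \<open>\<epsilon> > 0\<close> meet svd]
  have lw: "local_weight w \<mu> = w"
    using smooth by auto
  show bd: "Q \<in> pert_boundary m P \<epsilon> w"
    using spread_in_pert_boundary [OF w, of "lowering a s u v" \<epsilon> \<mu> P] \<open>\<epsilon> > 0\<close> sn(1)
      spectral_norm_lowering [OF svd a(1) an] by (simp add: lw Q_def)
  have eval: "mp_eval Q \<mu> = mp_eval (matpoly m P) \<mu> + lowering a s u v"
    unfolding Q_def by (rule mp_eval_spread [OF w])
  have "cinner (mp_eval (mp_deriv Q) \<mu> *v v ?n) (u ?n) = 0" if simple: "min_sv_mult ?n s = 1"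
  proof -
    let ?r = "cnj \<mu> / cmod \<mu> * complex_of_real (poly (pderiv w) (cmod \<mu>) / poly w (cmod \<mu>))"
    have "poly w (cmod \<mu>) > 0"
      by (rule weight_poly_pos [OF w]) simp
    have "lowering a s u v *v v ?n = - complex_of_real (s ?n) *s u ?n"
      using lowered_kernel [OF svd a(1) an] is_svdD(5) [OF svd n]
      by (simp add: matrix_vector_mult_add_rdistrib eq_neg_iff_add_eq_0 add.commute)
    then have "cinner (lowering a s u v *v v ?n) (u ?n) = - complex_of_real (s ?n)"
      using orthonormal_basisD(1) [OF is_svdD(1) [OF svd] n n] by (simp only: cinner_scale_left) simp
    then have "cinner (mp_eval (mp_deriv Q) \<mu> *v v ?n) (u ?n)
        = cinner (mp_eval (mp_deriv (matpoly m P)) \<mu> *v v ?n) (u ?n) - ?r * complex_of_real (s ?n)"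
      unfolding Q_def mp_eval_deriv_spread [OF w] matrix_vector_mult_add_rdistrib cscale_mult_vec
        cinner_add_left cinner_scale_left by simp
    also have "?r * complex_of_real (s ?n) = \<epsilon> * (cnj \<mu> / cmod \<mu>) * complex_of_real (poly (pderiv w) (cmod \<mu>))"
      using \<open>poly w (cmod \<mu>) > 0\<close> by (simp add: sn(1))
    also have "cinner (mp_eval (mp_deriv (matpoly m P)) \<mu> *v v ?n) (u ?n)
        = \<epsilon> * (cnj \<mu> / cmod \<mu>) * complex_of_real (poly (pderiv w) (cmod \<mu>))"
    proof (cases "\<mu> = 0")
      case True
      then have "coeff w 1 = 0"
        using smooth by (metis const_weight_def coeff_pCons_Suc coeff_0 One_nat_def)
      then show ?thesis
        using meeting_point_simple(2) [OF w \<open>\<epsilon> > 0\<close> meet svd simple] True by simp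
    next
      case False
      then show ?thesis
        by (rule meeting_point_simple(1) [OF w \<open>\<epsilon> > 0\<close> meet svd simple])
    qed
    finally show ?thesis
      by simp
  qed
  then have "[:-\<mu>, 1:]\<^sup>2 dvd det Q"
    by (rule lowered_double_zero [OF svd a eval])
  then show "multiple_eigenvalue Q \<mu>"
    by (rule multiple_eigenvalueI [OF det_perturbed_neq_0 [OF proper bd]])
  assume simple: "min_sv_mult ?n s = 1"
  have "geo_mult Q \<mu> = vec.dim (vec.span {v ?n})"
    unfolding geo_mult_def eval lowered_kernel_simple [OF svd a(1) an sn(2) simple] ..
  also have "\<dots> = 1"
    using orthonormal_basisD(3) [OF is_svdD(2) [OF svd] n]
    by (simp add: vec.dim_span vec.dim_eq_card_independent)
  finally show "geo_mult Q \<mu> = 1" .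
qed

text \<open>At the origin \<open>w(\<bar>z\<bar>)\<close> has a corner of slope \<open>w\<^sub>1\<close>, and the absence of a descent direction only
  yields \<open>\<bar>u\<^sub>n\<^sup>*P\<^sub>1v\<^sub>n\<bar> \<le> \<epsilon>w\<^sub>1\<close>. This is just what is needed to cancel that number by an admissible
  perturbation of \<open>P\<^sub>1\<close>.\<close>
lemma multiple_eigenvalue_at_origin:
  fixes P :: "nat \<Rightarrow> complex^'n^'n::finite"
  assumes "m \<ge> 1" and w: "weight_poly m w" and "\<epsilon> > 0" and meet: "components_meet m P w \<epsilon> G1 G2 0"
    and proper: "pseudospectrum m P w \<epsilon> \<noteq> UNIV"
  shows "\<exists>Q\<in>pert_boundary m P \<epsilon> w. multiple_eigenvalue Q 0"
proof -
  let ?n = "CARD('n)" and ?A = "mp_eval (matpoly m P) 0"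
  have n: "?n \<in> {1..?n}"
    by simp
  have w0: "coeff w 0 > 0"
    using w by (simp add: weight_poly_def)
  have "x = 0" if "?A *v x = 0" for x
  proof (rule ccontr)
    assume "x \<noteq> 0"
    then have "norm (complex_of_real (inverse (norm x)) *s x) = 1"
      by (simp add: norm_cscale norm_inverse)
    moreover have "?A *v (complex_of_real (inverse (norm x)) *s x) = 0"
      using that by (simp add: vec.scale)
    ultimately have "0 \<in> strict_sublevel (matpoly m P) w \<epsilon>"
      unfolding strict_sublevel_def using w0 \<open>\<epsilon> > 0\<close> by (auto simp: poly_0_coeff_0 intro!: exI)
    then show False
      using components_meet_boundary [OF w meet] by blast
  qed
  then obtain s u v where svd: "is_svd ?A s u v"
    using svd_exists by blast
  define a where "a = ?n - min_sv_mult ?n s + 1"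
  have a: "1 \<le> a" "a \<le> ?n"
    using min_sv_mult_ge_1 [of ?n s] n unfolding a_def atLeastAtMost_iff by arith+
  note sn = meeting_point_svd(1,2) [OF w \<open>\<epsilon> > 0\<close> meet svd]
  \<comment> \<open>A multiple \<open>s\<^sub>n\<close> yields a double zero already with the perturbation of \<open>P\<^sub>0\<close>, and \<open>P\<^sub>1\<close> is left alone.\<close>
  define g where "g = (if min_sv_mult ?n s = 1 then cinner (mp_eval (mp_deriv (matpoly m P)) 0 *v v ?n) (u ?n) else 0)"
  have g: "cmod g \<le> \<epsilon> * coeff w 1"
    using meeting_point_simple(2) [OF w \<open>\<epsilon> > 0\<close> meet svd] weight_poly_coeff_nonneg [OF w, of 1] \<open>\<epsilon> > 0\<close>
    by (simp add: g_def)
  define D where "D j = (if j = 0 then lowering a s u v else if j = 1 then cscale (- g) (outer (u ?n) (v ?n)) else 0)" for j :: nat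
  define Q where "Q = matpoly m (\<lambda>j. P j + D j)"
  have un: "norm (u ?n) = 1" and vn: "norm (v ?n) = 1"
    using orthonormal_basisD(2) [OF is_svdD(1) [OF svd] n] orthonormal_basisD(2) [OF is_svdD(2) [OF svd] n] by auto
  have D0: "spectral_norm (D 0) = \<epsilon> * coeff w 0"
    using spectral_norm_lowering [OF svd a] sn(1) by (simp add: D_def poly_0_coeff_0)
  have "spectral_norm (D 1) \<le> cmod g * 1"
    using spectral_norm_outer_le [of "u ?n" "v ?n"] un vn
    by (simp add: D_def spectral_norm_cscale mult_left_le)
  moreover have "spectral_norm (D j) \<le> \<epsilon> * coeff w j" if "j \<noteq> 0" "j \<noteq> 1" for j
    by (rule spectral_norm_le)
       (use that weight_poly_coeff_nonneg [OF w, of j] \<open>\<epsilon> > 0\<close> in \<open>simp add: D_def\<close>)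
  ultimately have "spectral_norm (D j) \<le> \<epsilon> * coeff w j" for j
    using D0 g by (cases "j = 0"; cases "j = 1") auto
  then have bd: "Q \<in> pert_boundary m P \<epsilon> w"
    unfolding pert_boundary_def Q_def using D0 w0 by blast
  have "(\<Sum>j\<le>m. cscale (0 ^ j) (D j)) = (\<Sum>j\<in>{0}. cscale (0 ^ j) (D j))"
    by (rule sum.mono_neutral_right) (auto simp: vec_eq_iff)
  then have eval: "mp_eval Q 0 = ?A + lowering a s u v"
    by (simp add: Q_def mp_eval_perturbed vec_eq_iff D_def)
  have "cinner (mp_eval (mp_deriv Q) 0 *v v ?n) (u ?n) = 0" if "min_sv_mult ?n s = 1"
  proof -
    have "(\<Sum>j\<le>m. cscale (of_nat j * 0 ^ (j - 1)) (D j)) = (\<Sum>j\<in>{1}. cscale (of_nat j * 0 ^ (j - 1)) (D j))"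
      by (rule sum.mono_neutral_right) (use \<open>m \<ge> 1\<close> in \<open>auto simp: vec_eq_iff\<close>)
    also have "\<dots> = D 1"
      by (simp add: vec_eq_iff)
    finally have "mp_eval (mp_deriv Q) 0 = mp_eval (mp_deriv (matpoly m P)) 0 + D 1"
      by (simp add: Q_def mp_eval_mp_deriv_matpoly vec_eq_iff distrib_left sum.distrib)
    then have "cinner (mp_eval (mp_deriv Q) 0 *v v ?n) (u ?n)
        = cinner (mp_eval (mp_deriv (matpoly m P)) 0 *v v ?n) (u ?n) + cinner (D 1 *v v ?n) (u ?n)"
      by (simp add: matrix_vector_mult_add_rdistrib cinner_add_left)
    also have "D 1 *v v ?n = - g *s (cinner (v ?n) (v ?n) *s u ?n)"
      by (simp add: D_def cscale_mult_vec outer_mult_vec)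
    also have "cinner \<dots> (u ?n) = - g"
      using orthonormal_basisD(1) [OF is_svdD(1) [OF svd] n n] orthonormal_basisD(1) [OF is_svdD(2) [OF svd] n n]
      by (simp only: cinner_scale_left) simp
    finally show ?thesis
      using that by (simp add: g_def)
  qed
  then have "[:-0, 1:]\<^sup>2 dvd det Q"
    by (rule lowered_double_zero [OF svd a(1) eq_refl [OF a_def] eval])
  then show ?thesis
    using bd multiple_eigenvalueI [OF det_perturbed_neq_0 [OF proper bd], of 0] by blast
qed

theorem theorem18:
  fixes P :: "nat \<Rightarrow> complex^'n^'n::finite"
    and m :: nat and w :: "real poly" and \<epsilon> :: real
    and \<mu> :: complex and G1 G2 :: "complex set"
  assumes "m \<ge> 1"
    and "det (P m) \<noteq> 0"
    and "weight_poly m w"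
    and "\<epsilon> > 0"
    and "pseudospectrum m P w \<epsilon> \<noteq> UNIV"
    and "components_meet m P w \<epsilon> G1 G2 \<mu>"
  shows
    "(\<mu> \<noteq> 0 \<longrightarrow>
       (\<forall>s u v. is_svd (mp_eval (matpoly m P) \<mu>) s u v \<longrightarrow>
          (\<forall>Q\<in>{Q_hat m P w \<mu> s u v, Q_tilde m P w \<mu> s u v}.
             Q \<in> pert_boundary m P \<epsilon> w \<and> multiple_eigenvalue Q \<mu>)))
   \<and> (\<mu> = 0 \<and> w = const_weight w \<longrightarrow>
       (\<forall>s u v. is_svd (mp_eval (matpoly m P) \<mu>) s u v \<longrightarrow>
          (\<forall>Q\<in>{Q_hat m P w \<mu> s u v, Q_tilde m P w \<mu> s u v}.
             Q \<in> pert_boundary m P \<epsilon> (const_weight w) \<and> multiple_eigenvalue Q 0)))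
   \<and> (\<mu> = 0 \<and> w \<noteq> const_weight w \<and> bounded (pseudospectrum m P w \<epsilon>) \<and> G1 \<inter> G2 = {0} \<longrightarrow>
       (\<exists>Q\<in>pert_boundary m P \<epsilon> w. multiple_eigenvalue Q 0))
   \<and> (\<mu> \<noteq> 0 \<or> w = const_weight w \<longrightarrow>
       (\<forall>s u v. is_svd (mp_eval (matpoly m P) \<mu>) s u v \<and> min_sv_mult CARD('n) s = 1 \<longrightarrow>
          (\<forall>Q\<in>{Q_hat m P w \<mu> s u v, Q_tilde m P w \<mu> s u v}.
             defective_eigenvalue Q \<mu> \<and> geo_mult Q \<mu> = 1)))"
proof -
  have main: "Q \<in> pert_boundary m P \<epsilon> w \<and> multiple_eigenvalue Q \<mu>
      \<and> (min_sv_mult CARD('n) s = 1 \<longrightarrow> defective_eigenvalue Q \<mu> \<and> geo_mult Q \<mu> = 1)"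
    if smooth: "\<mu> \<noteq> 0 \<or> w = const_weight w" and svd: "is_svd (mp_eval (matpoly m P) \<mu>) s u v"
      and Q: "Q \<in> {Q_hat m P w \<mu> s u v, Q_tilde m P w \<mu> s u v}" for s u v Q
  proof -
    have "\<exists>a. 1 \<le> a \<and> a \<le> CARD('n) - min_sv_mult CARD('n) s + 1
        \<and> Q = matpoly m (\<lambda>j. P j + spread w \<mu> (lowering a s u v) j)"
      using Q unfolding Q_hat_def Q_tilde_def E_hat_eq_lowering E_tilde_eq_lowering by fastforce
    then obtain a where a: "1 \<le> a" "a \<le> CARD('n) - min_sv_mult CARD('n) s + 1"
      and Q_eq: "Q = matpoly m (\<lambda>j. P j + spread w \<mu> (lowering a s u v) j)"
      by blast
    note mult = spread_lowering_multiple [OF assms(3,4,6,5) smooth svd a, folded Q_eq]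
    have "defective_eigenvalue Q \<mu>" if "min_sv_mult CARD('n) s = 1"
      using mult(2) mult(3) [OF that] by (simp add: defective_eigenvalue_def multiple_eigenvalue_def)
    then show ?thesis
      using mult by blast
  qed
  have "\<exists>Q\<in>pert_boundary m P \<epsilon> w. multiple_eigenvalue Q 0" if "\<mu> = 0"
    using multiple_eigenvalue_at_origin assms that by blast
  then show ?thesis
    using main by (smt (verit, ccfv_threshold))
qed

end
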